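(* Let $G$ be a connected signed graph. Then $G$ is not degree choosable if and only if each block of $G$ is a brick.
   Context: A signed graph is a finite graph (multiple edges allowed, no loops) with a sign map $\sigma$ assigning $\pm1$ to each edge; degrees count edges with multiplicity. A coloring is a map $\phi:V(G)\to\mathbb{Z}$ with $\phi(v)\ne\sigma(e)\phi(w)$ for every edge $e$ with ends $v,w$. A list-assignment $L$ assigns a set $L(v)\subseteq\mathbb{Z}$ to each vertex; an $L$-coloring is a coloring with $\phi(v)\in L(v)$. $G$ is degree choosable if $G$ is $L$-colorable for every list-assignment $L$ with $|L(v)|=d_G(v)$ for all $v$. The sign product of a subgraph is the product of its edge signs; $G$ is balanced if every cycle has positive sign product (equivalently, $V(G)$ can be partitioned into sets $X,Y$, possibly empty, such that an edge is negative iff it joins $X$ and $Y$). A block of $G$ is a maximal connected subgraph without a separating vertex. A brick is a signed graph of one of the following types: a balanced complete graph (underlying graph a simple $K_n$, $n\ge1$); a balanced odd cycle; an unbalanced even cycle; $2K_n$ for $n\ge2$; $2C_n$ for odd $n\ge3$. Here a cycle is a signed graph whose underlying graph is a cycle, and for a simple graph $H$, $2H$ denotes the signed graph obtained by replacing each edge of $H$ by a pair of parallel edges, one positive and one negative. *)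

theory Defs
  imports Complex_Main
begin

record ('a, 'e) sgraph =
  verts :: "'a set"
  edges :: "'e set"
  ends  :: "'e \<Rightarrow> 'a set"
  esign :: "'e \<Rightarrow> int"

definition signed_graph :: "('a, 'e) sgraph \<Rightarrow> bool" where
  "signed_graph G \<longleftrightarrow>
     finite (verts G) \<and> finite (edges G) \<and>
     (\<forall>e\<in>edges G. ends G e \<subseteq> verts G \<and> card (ends G e) = 2 \<and> esign G e \<in> {1, -1})"

definition degree :: "('a, 'e) sgraph \<Rightarrow> 'a \<Rightarrow> nat" where
  "degree G v = card {e \<in> edges G. v \<in> ends G e}"


subsection \<open>Colorings\<close>

definition coloring :: "('a, 'e) sgraph \<Rightarrow> ('a \<Rightarrow> int) \<Rightarrow> bool" where
  "coloring G \<phi> \<longleftrightarrow>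
     (\<forall>e\<in>edges G. \<forall>v w. ends G e = {v, w} \<longrightarrow> \<phi> v \<noteq> esign G e * \<phi> w)"

definition list_coloring :: "('a, 'e) sgraph \<Rightarrow> ('a \<Rightarrow> int set) \<Rightarrow> ('a \<Rightarrow> int) \<Rightarrow> bool" where
  "list_coloring G L \<phi> \<longleftrightarrow> coloring G \<phi> \<and> (\<forall>v\<in>verts G. \<phi> v \<in> L v)"

text \<open>Finiteness of the lists is explicit because \<^const>\<open>card\<close> is 0 on infinite sets.\<close>

definition degree_choosable :: "('a, 'e) sgraph \<Rightarrow> bool" where
  "degree_choosable G \<longleftrightarrow>
     (\<forall>L. (\<forall>v\<in>verts G. finite (L v) \<and> card (L v) = degree G v) \<longrightarrow>
          (\<exists>\<phi>. list_coloring G L \<phi>))"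


subsection \<open>Subgraphs, connectedness and blocks\<close>

text \<open>A subgraph carries the same total functions \<^const>\<open>ends\<close> and \<^const>\<open>esign\<close>, so it is
  determined by its vertex set and edge set, and the subgraph relation is antisymmetric.\<close>

definition subgraph :: "('a, 'e) sgraph \<Rightarrow> ('a, 'e) sgraph \<Rightarrow> bool" where
  "subgraph H G \<longleftrightarrow>
     signed_graph H \<and> verts H \<subseteq> verts G \<and> edges H \<subseteq> edges G \<and>
     ends H = ends G \<and> esign H = esign G"

definition adjacent :: "('a, 'e) sgraph \<Rightarrow> 'a \<Rightarrow> 'a \<Rightarrow> bool" where
  "adjacent G x y \<longleftrightarrow> (\<exists>e\<in>edges G. ends G e = {x, y})"

definition reachable :: "('a, 'e) sgraph \<Rightarrow> 'a \<Rightarrow> 'a \<Rightarrow> bool" where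
  "reachable G = (adjacent G)\<^sup>*\<^sup>*"

definition connected_graph :: "('a, 'e) sgraph \<Rightarrow> bool" where
  "connected_graph G \<longleftrightarrow>
     verts G \<noteq> {} \<and> (\<forall>x\<in>verts G. \<forall>y\<in>verts G. reachable G x y)"

definition remove_vertex :: "('a, 'e) sgraph \<Rightarrow> 'a \<Rightarrow> ('a, 'e) sgraph" where
  "remove_vertex G v =
     G\<lparr>verts := verts G - {v}, edges := {e \<in> edges G. v \<notin> ends G e}\<rparr>"

definition separating_vertex :: "('a, 'e) sgraph \<Rightarrow> 'a \<Rightarrow> bool" where
  "separating_vertex G v \<longleftrightarrow>
     v \<in> verts G \<and>
     (\<exists>x\<in>verts G - {v}. \<exists>y\<in>verts G - {v}.
        reachable G x y \<and> \<not> reachable (remove_vertex G v) x y)"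

definition nonseparable :: "('a, 'e) sgraph \<Rightarrow> bool" where
  "nonseparable G \<longleftrightarrow> connected_graph G \<and> (\<nexists>v. separating_vertex G v)"

definition block :: "('a, 'e) sgraph \<Rightarrow> ('a, 'e) sgraph \<Rightarrow> bool" where
  "block B G \<longleftrightarrow>
     subgraph B G \<and> nonseparable B \<and>
     (\<forall>H. subgraph H G \<and> nonseparable H \<and> subgraph B H \<longrightarrow> H = B)"


subsection \<open>Cycles and balance\<close>

text \<open>Cycles are understood in the multigraph sense: two parallel edges form a cycle of
  length 2. This is needed for the equivalence of balance with the bipartition condition.\<close>

definition cycle_graph :: "nat \<Rightarrow> ('a, 'e) sgraph \<Rightarrow> bool" where
  "cycle_graph n G \<longleftrightarrow> n \<ge> 2 \<and>
     (\<exists>vs es. length vs = n \<and> length es = n \<and> distinct vs \<and> distinct es \<and>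
        verts G = set vs \<and> edges G = set es \<and>
        (\<forall>i<n. ends G (es ! i) = {vs ! i, vs ! (Suc i mod n)}))"

definition sign_product :: "('a, 'e) sgraph \<Rightarrow> int" where
  "sign_product G = (\<Prod>e\<in>edges G. esign G e)"

definition balanced :: "('a, 'e) sgraph \<Rightarrow> bool" where
  "balanced G \<longleftrightarrow>
     (\<forall>C n. subgraph C G \<and> cycle_graph n C \<longrightarrow> sign_product C > 0)"


subsection \<open>Bricks\<close>

text \<open>A simple graph is given by its vertex set \<open>V\<close> and a set \<open>F\<close> of two-element subsets of \<open>V\<close>.\<close>

definition complete_edges :: "'a set \<Rightarrow> 'a set set" where
  "complete_edges V = {{x, y} | x y. x \<in> V \<and> y \<in> V \<and> x \<noteq> y}"

definition cycle_edges :: "'a list \<Rightarrow> 'a set set" where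
  "cycle_edges vs = {{vs ! i, vs ! (Suc i mod length vs)} | i. i < length vs}"

definition underlying_simple :: "('a, 'e) sgraph \<Rightarrow> 'a set \<Rightarrow> 'a set set \<Rightarrow> bool" where
  "underlying_simple G V F \<longleftrightarrow> verts G = V \<and> bij_betw (ends G) (edges G) F"

definition doubled :: "('a, 'e) sgraph \<Rightarrow> 'a set \<Rightarrow> 'a set set \<Rightarrow> bool" where
  "doubled G V F \<longleftrightarrow>
     verts G = V \<and>
     bij_betw (ends G) {e \<in> edges G. esign G e = 1} F \<and>
     bij_betw (ends G) {e \<in> edges G. esign G e = -1} F"

definition complete_graph :: "nat \<Rightarrow> ('a, 'e) sgraph \<Rightarrow> bool" where
  "complete_graph n G \<longleftrightarrow>
     (\<exists>V. finite V \<and> card V = n \<and> underlying_simple G V (complete_edges V))"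

definition doubled_complete :: "nat \<Rightarrow> ('a, 'e) sgraph \<Rightarrow> bool" where
  "doubled_complete n G \<longleftrightarrow>
     (\<exists>V. finite V \<and> card V = n \<and> doubled G V (complete_edges V))"

definition doubled_cycle :: "nat \<Rightarrow> ('a, 'e) sgraph \<Rightarrow> bool" where
  "doubled_cycle n G \<longleftrightarrow>
     (\<exists>vs. distinct vs \<and> length vs = n \<and> doubled G (set vs) (cycle_edges vs))"

definition brick :: "('a, 'e) sgraph \<Rightarrow> bool" where
  "brick G \<longleftrightarrow> signed_graph G \<and>
     ((\<exists>n\<ge>1. complete_graph n G \<and> balanced G) \<or>
      (\<exists>n. odd n \<and> cycle_graph n G \<and> balanced G) \<or>
      (\<exists>n. even n \<and> cycle_graph n G \<and> \<not> balanced G) \<or>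
      (\<exists>n\<ge>2. doubled_complete n G) \<or>
      (\<exists>n\<ge>3. odd n \<and> doubled_cycle n G))"

end

theory Submission
  imports Defs
begin

text \<open>
  Call a list assignment with lists of size at least the degree \<^emph>\<open>bad\<close> if it admits no coloring.
  Coloring a connected graph greedily towards a vertex with a spare color shows that bad lists
  have size exactly the degree, that badness passes to induced subgraphs, and that any coloring of
  a vertex set with connected complement must forbid distinct list colors along distinct edges.
  If \<open>G\<close> is nonseparable, removing one vertex gives \<open>L w = \<sigma> e \<cdot> L v\<close> for every edge \<open>e = vw\<close>;
  in particular \<open>G\<close> is regular. Removing two neighbours \<open>u\<close>, \<open>w\<close> of \<open>v\<close> without disconnecting \<open>G\<close>
  forces an edge \<open>uw\<close> closing a positive triangle, exactly as in Lovasz's proof of Brooks' theorem.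
  So either no pair of vertices separates and \<open>G\<close> is complete (simple and balanced, or doubled), or
  the underlying simple graph is a cycle, whose sign and parity are read off explicit colorings.
  Conversely, bricks have bad lists without the color \<open>0\<close>, and bad lists of two graphs sharing one
  vertex are glued after multiplying one of them by a large integer.
\<close>

subsection \<open>Induced subgraphs and reachability\<close>

text \<open>Lists of size at least the degree are the right class because deleting the colors
  forbidden by colored neighbours preserves the inequality, while connectedness restores equality;
  the structural facts come from comparing the two. The obstacle is the non-complete case. If x, y
  separate G, a neighbour u of x in one component and w in another can be chosen so that G - u - w
  stays connected unless x has no third neighbour; as u and w are not adjacent, x has exactly two
  neighbours. Edges have multiplicity at most 2, so the common degree r is at most 4. A doubled edge
  makes the lists at its ends closed under negation and free of 0, hence of even size, so r = 3 is
  impossible; r = 2 makes the graph a simple cycle, while for r = 4 the property of having two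
  neighbours must be spread over the graph edge by edge. In the converse the lists of two parts have
  to be disjoint at the shared vertex. Scaling by a large factor can move every color except 0,
  which is why 0 is excluded from all lists constructed.\<close>

definition induced :: "('a, 'e) sgraph \<Rightarrow> 'a set \<Rightarrow> ('a, 'e) sgraph" where
  "induced G U = G\<lparr>verts := U, edges := {e \<in> edges G. ends G e \<subseteq> U}\<rparr>"

lemma induced_simps [simp]:
  "verts (induced G U) = U"
  "edges (induced G U) = {e \<in> edges G. ends G e \<subseteq> U}"
  "ends (induced G U) = ends G"
  "esign (induced G U) = esign G"
  by (simp_all add: induced_def)

lemma signed_graph_induced [simp]:
  "signed_graph G \<Longrightarrow> U \<subseteq> verts G \<Longrightarrow> signed_graph (induced G U)"
  by (auto simp: signed_graph_def intro: finite_subset)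

lemma adjacent_induced:
  "adjacent (induced G U) x y \<longleftrightarrow> adjacent G x y \<and> x \<in> U \<and> y \<in> U"
  by (auto simp: adjacent_def)

lemma remove_vertex_induced:
  "signed_graph G \<Longrightarrow> remove_vertex G v = induced G (verts G - {v})"
  unfolding remove_vertex_def induced_def signed_graph_def
  by (rule sgraph.equality) auto

lemma adjacent_sym: "adjacent G x y \<longleftrightarrow> adjacent G y x"
  by (simp add: adjacent_def insert_commute)

lemma adjacentD:
  assumes "signed_graph G" "adjacent G x y"
  shows "x \<in> verts G" "y \<in> verts G" "x \<noteq> y"
  using assms unfolding signed_graph_def adjacent_def by fastforce+

lemma reachable_refl [simp]: "reachable G x x"
  by (simp add: reachable_def)

lemma reachable_sym: "reachable G x y \<Longrightarrow> reachable G y x"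
  unfolding reachable_def
  by (metis adjacent_sym sympD sympI symp_rtranclp)

lemma reachable_trans [trans]: "reachable G x y \<Longrightarrow> reachable G y z \<Longrightarrow> reachable G x z"
  unfolding reachable_def by (rule rtranclp_trans)

lemma reachable_adjacent: "adjacent G x y \<Longrightarrow> reachable G x y"
  unfolding reachable_def by blast

lemma reachable_step: "reachable G x y \<Longrightarrow> adjacent G y z \<Longrightarrow> reachable G x z"
  unfolding reachable_def by (rule rtranclp.rtrancl_into_rtrancl)

lemma reachable_mono:
  assumes "reachable G x y" "\<And>a b. adjacent G a b \<Longrightarrow> adjacent H a b"
  shows "reachable H x y"
  using assms unfolding reachable_def by (metis mono_rtranclp)

text \<open>Replaces explicit paths: with \<open>S\<close> a reachability class, a component or a
  level set of an invariant, the crossing edge \<open>s t\<close> is what the argument inspects, so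
  a property preserved along edges spreads over a connected graph.\<close>

lemma reachable_cut:
  assumes "reachable G a b" "a \<in> S" "b \<notin> S"
  shows "\<exists>s t. s \<in> S \<and> t \<notin> S \<and> adjacent G s t"
  using assms unfolding reachable_def by (induction rule: rtranclp_induct) auto

lemma reachable_verts:
  assumes "signed_graph G" "reachable G a b" "a \<in> verts G"
  shows "b \<in> verts G"
  using reachable_cut[OF assms(2,3)] adjacentD(2)[OF assms(1)] by blast

lemma signed_graphD:
  assumes "signed_graph G" "e \<in> edges G"
  shows "ends G e \<subseteq> verts G" "card (ends G e) = 2" "esign G e = 1 \<or> esign G e = -1"
  using assms unfolding signed_graph_def by auto

lemma edge_other_end:
  assumes "signed_graph G" "e \<in> edges G" "v \<in> ends G e"
  obtains w where "ends G e = {v, w}" "v \<noteq> w" "w \<in> verts G"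
proof -
  obtain a b where "ends G e = {a, b}" "a \<noteq> b"
    using signed_graphD(2)[OF assms(1,2)] by (auto simp: card_2_iff)
  with assms signed_graphD(1)[OF assms(1,2)] that show ?thesis
    by (cases "v = a") (auto simp: insert_commute)
qed

lemma edge_ends_neq: "signed_graph G \<Longrightarrow> e \<in> edges G \<Longrightarrow> ends G e = {v, w} \<Longrightarrow> v \<noteq> w"
  using signed_graphD(2)[of G e] by auto

lemma sign_swap: "s = 1 \<or> s = -1 \<Longrightarrow> (a::int) = s * b \<longleftrightarrow> b = s * a"
  by auto

lemma degree_induced_mono:
  "signed_graph G \<Longrightarrow> degree (induced G U) v \<le> degree G v"
  unfolding degree_def signed_graph_def by (auto intro!: card_mono)

subsection \<open>Greedy coloring\<close>

definition bad_lists :: "('a, 'e) sgraph \<Rightarrow> ('a \<Rightarrow> int set) \<Rightarrow> bool" where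
  "bad_lists G L \<longleftrightarrow>
     (\<forall>v\<in>verts G. finite (L v) \<and> degree G v \<le> card (L v)) \<and> (\<nexists>\<phi>. list_coloring G L \<phi>)"

text \<open>A set of colors, not a family indexed by edges: when two edges forbid the same color,
  \<open>v\<close> keeps a spare one, and this slack is what later arguments exploit.\<close>

definition forbidden :: "('a, 'e) sgraph \<Rightarrow> 'a set \<Rightarrow> ('a \<Rightarrow> int) \<Rightarrow> 'a \<Rightarrow> int set" where
  "forbidden G W \<phi> v = {esign G e * \<phi> w | e w. e \<in> edges G \<and> ends G e = {v, w} \<and> w \<in> W}"

section \<open>Extending a coloring of a part of the graph\<close>

lemma list_coloring_combine:
  assumes G: "signed_graph G" and U: "U \<subseteq> verts G"
    and \<phi>: "list_coloring (induced G (verts G - U)) L \<phi>"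
    and \<psi>: "list_coloring (induced G U) (\<lambda>v. L v - forbidden G (verts G - U) \<phi> v) \<psi>"
  shows "list_coloring G L (\<lambda>v. if v \<in> U then \<psi> v else \<phi> v)"
proof -
  let ?f = "\<lambda>v. if v \<in> U then \<psi> v else \<phi> v"
  have cross: "\<psi> v \<noteq> esign G e * \<phi> w"
    if "e \<in> edges G" "ends G e = {v, w}" "v \<in> U" "w \<notin> U" for e v w
  proof -
    have "w \<in> verts G - U" using that signed_graphD(1)[OF G that(1)] by auto
    then have "esign G e * \<phi> w \<in> forbidden G (verts G - U) \<phi> v"
      using that unfolding forbidden_def by blast
    then show ?thesis using \<psi> that(3) unfolding list_coloring_def by auto
  qed
  have "?f v \<noteq> esign G e * ?f w" if e: "e \<in> edges G" "ends G e = {v, w}" for e v w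
  proof (cases "v \<in> U"; cases "w \<in> U")
    assume "v \<in> U" "w \<in> U"
    then show ?thesis using \<psi> e unfolding list_coloring_def coloring_def by simp
  next
    assume "v \<in> U" "w \<notin> U"
    then show ?thesis using cross[OF e] by simp
  next
    assume "v \<notin> U" "w \<in> U"
    then show ?thesis using cross[of e w v] e sign_swap[OF signed_graphD(3)[OF G e(1)]]
      by (auto simp: insert_commute)
  next
    assume "v \<notin> U" "w \<notin> U"
    then show ?thesis using \<phi> e signed_graphD(1)[OF G e(1)]
      unfolding list_coloring_def coloring_def by simp
  qed
  then show ?thesis using \<phi> \<psi> unfolding list_coloring_def coloring_def by auto
qed

text \<open>Indexing by edges, not by neighbours, counts parallel edges separately, since they may
  forbid different colors. \<open>the_elem (ends G e - {v})\<close> is the other end of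
  \<open>e\<close>. Both the cardinality bound and the injectivity in the tight case are read off
  this image.\<close>

lemma forbidden_image:
  assumes G: "signed_graph G" and "v \<in> U"
  shows "forbidden G (verts G - U) \<phi> v =
    (\<lambda>e. esign G e * \<phi> (the_elem (ends G e - {v}))) `
      {e \<in> edges G. v \<in> ends G e \<and> \<not> ends G e \<subseteq> U}"
proof -
  have other: "the_elem (ends G e - {v}) = w" if "e \<in> edges G" "ends G e = {v, w}" for e w
  proof -
    have "ends G e - {v} = {w}" using that edge_ends_neq[OF G] by auto
    then show ?thesis by simp
  qed
  show ?thesis (is "_ = ?f ` ?D")
  proof (intro set_eqI iffI)
    fix c assume "c \<in> forbidden G (verts G - U) \<phi> v"
    then obtain e w where e: "e \<in> edges G" "ends G e = {v, w}" "w \<in> verts G - U" "c = esign G e * \<phi> w"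
      unfolding forbidden_def by blast
    then show "c \<in> ?f ` ?D" using other[OF e(1,2)] by (intro image_eqI[of _ _ e]) auto
  next
    fix c assume "c \<in> ?f ` ?D"
    then obtain e where e: "e \<in> edges G" "v \<in> ends G e" "\<not> ends G e \<subseteq> U" "c = ?f e" by blast
    obtain w where w: "ends G e = {v, w}" "w \<in> verts G" using edge_other_end[OF G e(1,2)] .
    have "c = esign G e * \<phi> w" "w \<in> verts G - U"
      using e other[OF e(1) w(1)] w assms(2) by simp_all
    then show "c \<in> forbidden G (verts G - U) \<phi> v"
      using e(1) w(1) unfolding forbidden_def by blast
  qed
qed

lemma degree_induced_split:
  assumes G: "signed_graph G"
  shows "degree G v = degree (induced G U) v +
    card {e \<in> edges G. v \<in> ends G e \<and> \<not> ends G e \<subseteq> U}"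
proof -
  have fin: "finite (edges G)" using G by (simp add: signed_graph_def)
  have "{e \<in> edges G. v \<in> ends G e} =
      {e \<in> edges G. ends G e \<subseteq> U \<and> v \<in> ends G e} \<union> {e \<in> edges G. v \<in> ends G e \<and> \<not> ends G e \<subseteq> U}"
    by auto
  moreover have "card \<dots> = card {e \<in> edges G. ends G e \<subseteq> U \<and> v \<in> ends G e} +
      card {e \<in> edges G. v \<in> ends G e \<and> \<not> ends G e \<subseteq> U}"
    by (rule card_Un_disjoint) (use fin in auto)
  ultimately show ?thesis unfolding degree_def by (simp add: conj_ac)
qed

lemma degree_induced_less:
  assumes G: "signed_graph G" and "adjacent G s t" "t \<notin> U"
  shows "degree (induced G U) s < degree G s"
proof -
  let ?D = "{e \<in> edges G. s \<in> ends G e \<and> \<not> ends G e \<subseteq> U}"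
  obtain e where "e \<in> edges G" "ends G e = {s, t}" using assms(2) by (auto simp: adjacent_def)
  then have "e \<in> ?D" using assms(3) by auto
  moreover have "finite ?D" using G by (simp add: signed_graph_def)
  ultimately have "card ?D > 0" by (metis card_gt_0_iff empty_iff)
  then show ?thesis unfolding degree_induced_split[OF G, of s U] by simp
qed

lemma finite_forbidden:
  assumes "signed_graph G" "v \<in> U"
  shows "finite (forbidden G (verts G - U) \<phi> v)"
  unfolding forbidden_image[OF assms] using assms(1) by (simp add: signed_graph_def)

lemma card_forbidden:
  assumes "signed_graph G" "v \<in> U"
  shows "card (forbidden G (verts G - U) \<phi> v) \<le> card {e \<in> edges G. v \<in> ends G e \<and> \<not> ends G e \<subseteq> U}"
  unfolding forbidden_image[OF assms] using assms(1) by (intro card_image_le) (simp add: signed_graph_def)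

text \<open>A vertex of \<open>U\<close> loses at most one color per edge leaving \<open>U\<close>,
  and these are exactly the edges by which its degree drops; a coloring of the remainder would
  extend the given one.\<close>

lemma bad_lists_precolor:
  assumes G: "signed_graph G" and U: "U \<subseteq> verts G" and bad: "bad_lists G L"
    and \<phi>: "list_coloring (induced G (verts G - U)) L \<phi>"
  shows "bad_lists (induced G U) (\<lambda>v. L v - forbidden G (verts G - U) \<phi> v)"
  unfolding bad_lists_def
proof (intro conjI ballI)
  fix v assume "v \<in> verts (induced G U)"
  then have v: "v \<in> U" by simp
  then have L: "finite (L v)" "degree G v \<le> card (L v)"
    using bad U unfolding bad_lists_def by auto
  then show "finite (L v - forbidden G (verts G - U) \<phi> v)" by simp
  show "degree (induced G U) v \<le> card (L v - forbidden G (verts G - U) \<phi> v)"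
    using diff_card_le_card_Diff[OF finite_forbidden[OF G v], of "L v" \<phi>]
      card_forbidden[OF G v, of \<phi>] L(2) degree_induced_split[OF G, of v U] by linarith
next
  show "\<nexists>\<psi>. list_coloring (induced G U) (\<lambda>v. L v - forbidden G (verts G - U) \<phi> v) \<psi>"
    using list_coloring_combine[OF G U \<phi>] bad unfolding bad_lists_def by blast
qed

text \<open>Vertices with slack are removed one at a time: removing \<open>z\<close> leaves slack at
  each neighbour of \<open>z\<close>, and once the rest is colored the forbidden colors cannot
  exhaust the list of \<open>z\<close>. Slack is demanded within reach of every vertex, not for a
  connected graph, because removing \<open>z\<close> may disconnect.\<close>

lemma greedy_list_coloring:
  assumes "signed_graph G"
    and "\<And>v. v \<in> verts G \<Longrightarrow> finite (L v) \<and> degree G v \<le> card (L v)"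
    and "\<And>v. v \<in> verts G \<Longrightarrow> \<exists>z\<in>verts G. reachable G v z \<and> degree G z < card (L z)"
  shows "\<exists>\<phi>. list_coloring G L \<phi>"
  using assms
proof (induction "card (verts G)" arbitrary: G)
  case 0
  then have "verts G = {}" by (simp add: signed_graph_def)
  moreover then have "edges G = {}"
    using signed_graphD(1,2)[OF 0(2)] by force
  ultimately show ?case by (auto simp: list_coloring_def coloring_def)
next
  case (Suc n)
  note G = Suc.prems(1)
  have finV: "finite (verts G)" using G by (simp add: signed_graph_def)
  obtain v0 where "v0 \<in> verts G" using Suc(2) by fastforce
  then obtain z where z: "z \<in> verts G" "degree G z < card (L z)" using Suc.prems(3) by blast
  let ?H = "induced G (verts G - {z})"
  have H: "signed_graph ?H" using G by simp
  have strict: "degree ?H s < card (L s)" if sz: "s \<in> verts G" "adjacent G s z" for s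
    using degree_induced_less[OF G sz(2), of "verts G - {z}"] Suc.prems(2)[OF sz(1)] by simp
  have "\<exists>\<phi>. list_coloring ?H L \<phi>"
  proof (rule Suc.hyps(1)[OF _ H])
    show "n = card (verts ?H)" using Suc(2) z finV by simp
    show "finite (L v) \<and> degree ?H v \<le> card (L v)" if "v \<in> verts ?H" for v
      using that Suc.prems(2)[of v] degree_induced_mono[OF G, of "verts G - {z}" v] by auto
    show "\<exists>z'\<in>verts ?H. reachable ?H v z' \<and> degree ?H z' < card (L z')"
      if v: "v \<in> verts ?H" for v
    proof (rule ccontr)
      assume none: "\<not> ?thesis"
      obtain y where y: "y \<in> verts G" "reachable G v y" "degree G y < card (L y)"
        using Suc.prems(3)[of v] v by auto
      \<comment> \<open>If the old slack vertex \<open>y\<close> is lost, being \<open>z\<close> or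
        cut off by it, then a walk to \<open>y\<close> leaves the component through a neighbour of
        \<open>z\<close>, which has gained slack.\<close>
      let ?S = "{s. reachable ?H v s}"
      have "y \<notin> ?S"
        using none y v reachable_verts[OF H] degree_induced_mono[OF G, of "verts G - {z}" y]
        by fastforce
      then obtain s t where st: "reachable ?H v s" "\<not> reachable ?H v t" "adjacent G s t"
        using reachable_cut[OF y(2), of ?S] by auto
      have s: "s \<in> verts G - {z}" using reachable_verts[OF H st(1) v] by simp
      have "t \<notin> verts G - {z}"
        using st s reachable_step[OF st(1)] by (auto simp: adjacent_induced)
      then have "t = z" using adjacentD(2)[OF G st(3)] by simp
      then show False using none strict[of s] st s by auto
    qed
  qed
  then obtain \<phi> where \<phi>: "list_coloring ?H L \<phi>" by blast
  let ?F = "forbidden G (verts G - {z}) \<phi> z"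
  have "card ?F \<le> degree G z"
    using card_forbidden[OF G, of z "{z}" \<phi>] degree_induced_split[OF G, of z "{z}"] by simp
  then have "card ?F < card (L z)" using z(2) by simp
  moreover have "finite ?F" using finite_forbidden[OF G, of z "{z}"] by simp
  ultimately obtain c where c: "c \<in> L z" "c \<notin> ?F" by (meson card_mono leD subsetI)
  have "edges (induced G {z}) = {}"
  proof -
    have "\<not> ends G e \<subseteq> {z}" if "e \<in> edges G" for e
      using card_mono[of "{z}" "ends G e"] signed_graphD(2)[OF G that] by auto
    then show ?thesis by auto
  qed
  then have "list_coloring (induced G {z}) (\<lambda>v. L v - forbidden G (verts G - {z}) \<phi> v) (\<lambda>_. c)"
    using c by (auto simp: list_coloring_def coloring_def)
  then show ?case using list_coloring_combine[OF G _ \<phi>] z(1) by blast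
qed

lemma bad_lists_tight:
  assumes "signed_graph G" "connected_graph G" "bad_lists G L" "v \<in> verts G"
  shows "card (L v) = degree G v"
proof (rule ccontr)
  assume "card (L v) \<noteq> degree G v"
  then have "degree G v < card (L v)" using assms(3,4) unfolding bad_lists_def by force
  then have "\<exists>\<phi>. list_coloring G L \<phi>"
    using assms by (intro greedy_list_coloring) (auto simp: bad_lists_def connected_graph_def)
  then show False using assms(3) by (simp add: bad_lists_def)
qed

text \<open>Tightness turns lists of size at least the degree into lists of size exactly the degree,
  the form used by \<open>degree_choosable\<close>.\<close>

lemma not_degree_choosable_iff:
  assumes "signed_graph G" "connected_graph G"
  shows "\<not> degree_choosable G \<longleftrightarrow> (\<exists>L. bad_lists G L)"
proof
  assume "\<not> degree_choosable G"
  then show "\<exists>L. bad_lists G L" unfolding degree_choosable_def bad_lists_def by fastforce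
next
  assume "\<exists>L. bad_lists G L"
  then obtain L where L: "bad_lists G L" by blast
  then have "\<forall>v\<in>verts G. finite (L v) \<and> card (L v) = degree G v" "\<nexists>\<phi>. list_coloring G L \<phi>"
    using bad_lists_tight[OF assms L] unfolding bad_lists_def by auto
  then show "\<not> degree_choosable G" unfolding degree_choosable_def by blast
qed

text \<open>Every component of \<open>G\<close> minus \<open>U\<close> has an edge into
  \<open>U\<close>, as \<open>U\<close> is nonempty and \<open>G\<close> connected. The end of that
  edge outside \<open>U\<close> has slack, so the complement can be colored greedily and what is
  left on \<open>U\<close> is bad.\<close>

lemma bad_lists_induced:
  assumes G: "signed_graph G" and conn: "connected_graph G" and bad: "bad_lists G L"
    and U: "U \<subseteq> verts G" "U \<noteq> {}"
  shows "\<exists>L'. bad_lists (induced G U) L'"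
proof -
  let ?H = "induced G (verts G - U)"
  have H: "signed_graph ?H" using G by simp
  have "\<exists>\<phi>. list_coloring ?H L \<phi>"
  proof (rule greedy_list_coloring[OF H])
    fix v assume v: "v \<in> verts ?H"
    then show "finite (L v) \<and> degree ?H v \<le> card (L v)"
      using bad degree_induced_mono[OF G, of "verts G - U" v] unfolding bad_lists_def by force
    show "\<exists>z\<in>verts ?H. reachable ?H v z \<and> degree ?H z < card (L z)"
    proof -
      obtain u where u: "u \<in> U" using U by auto
      then have "reachable G v u" using conn v U by (auto simp: connected_graph_def)
      moreover have "u \<notin> {s. reachable ?H v s}" using reachable_verts[OF H _ v] u by auto
      ultimately obtain s t where st: "reachable ?H v s" "\<not> reachable ?H v t" "adjacent G s t"
        using reachable_cut[of G v u "{s. reachable ?H v s}"] by auto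
      have s: "s \<in> verts G - U" using reachable_verts[OF H st(1) v] by simp
      have t: "t \<notin> verts G - U"
        using st s reachable_step[OF st(1)] by (auto simp: adjacent_induced)
      have "degree G s \<le> card (L s)" using bad s by (simp add: bad_lists_def)
      then have "degree ?H s < card (L s)" using degree_induced_less[OF G st(3) t] by simp
      then show ?thesis using st(1) s by auto
    qed
  qed
  then show ?thesis using bad_lists_precolor[OF G U(1) bad] by blast
qed

text \<open>By connectedness of the part on \<open>U\<close>, the reduced lists have size exactly
  the degree there. Hence \<open>v\<close> loses as many colors as it has edges leaving
  \<open>U\<close>, which leaves no room for a forbidden color outside \<open>L v\<close> nor for
  two edges forbidding the same color.\<close>

lemma forbidden_tight:
  assumes G: "signed_graph G" and bad: "bad_lists G L" and U: "U \<subseteq> verts G"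
    and conn: "connected_graph (induced G U)"
    and \<phi>: "list_coloring (induced G (verts G - U)) L \<phi>" and v: "v \<in> U"
  shows "forbidden G (verts G - U) \<phi> v \<subseteq> L v"
    and "\<And>e e' w w'. \<lbrakk>e \<in> edges G; e' \<in> edges G; e \<noteq> e'; ends G e = {v, w}; ends G e' = {v, w'};
           w \<in> verts G - U; w' \<in> verts G - U\<rbrakk> \<Longrightarrow> esign G e * \<phi> w \<noteq> esign G e' * \<phi> w'"
proof -
  let ?F = "forbidden G (verts G - U) \<phi> v"
  let ?D = "{e \<in> edges G. v \<in> ends G e \<and> \<not> ends G e \<subseteq> U}"
  let ?f = "\<lambda>e. esign G e * \<phi> (the_elem (ends G e - {v}))"
  have finD: "finite ?D" using G by (simp add: signed_graph_def)
  have eq: "card (L v - ?F) = degree (induced G U) v"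
    using bad_lists_tight[OF _ conn bad_lists_precolor[OF G U bad \<phi>]] G U v by simp
  have fL: "finite (L v)" "degree G v \<le> card (L v)" using bad v U by (auto simp: bad_lists_def)
  have "card (L v - ?F) = card (L v) - card (L v \<inter> ?F)"
    using fL by (metis card_Diff_subset_Int finite_Int)
  moreover have "card (L v \<inter> ?F) \<le> card ?F"
    using finite_forbidden[OF G v] by (intro card_mono) auto
  ultimately have c: "card (L v \<inter> ?F) = card ?F" "card ?F = card ?D"
    using card_forbidden[OF G v, of \<phi>] eq fL(2) degree_induced_split[OF G, of v U] by linarith+
  show "?F \<subseteq> L v"
    using c(1) finite_forbidden[OF G v] by (metis card_subset_eq inf.orderI inf_le2 inf_commute)
  have inj: "inj_on ?f ?D"
    using c(2) finD unfolding forbidden_image[OF G v] by (intro eq_card_imp_inj_on) auto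
  fix e e' w w' assume *: "e \<in> edges G" "e' \<in> edges G" "e \<noteq> e'" "ends G e = {v, w}" "ends G e' = {v, w'}"
    "w \<in> verts G - U" "w' \<in> verts G - U"
  have "ends G e - {v} = {w}" "ends G e' - {v} = {w'}" using * v by auto
  then show "esign G e * \<phi> w \<noteq> esign G e' * \<phi> w'"
    using inj_onD[OF inj, of e e'] * by auto
qed

text \<open>The second vertex \<open>w\<close> keeps the remaining graph nonempty, as
  \<open>connected_graph\<close> demands.\<close>

lemma nonseparable_remove:
  assumes G: "signed_graph G" "nonseparable G" and "v \<in> verts G" "w \<in> verts G" "v \<noteq> w"
  shows "connected_graph (induced G (verts G - {v}))"
  unfolding connected_graph_def
proof (intro conjI ballI)
  show "verts (induced G (verts G - {v})) \<noteq> {}" using assms by auto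
  fix x y assume "x \<in> verts (induced G (verts G - {v}))" "y \<in> verts (induced G (verts G - {v}))"
  then have xy: "x \<in> verts G - {v}" "y \<in> verts G - {v}" by auto
  then have "reachable G x y" using G(2) by (auto simp: nonseparable_def connected_graph_def)
  moreover have "\<not> separating_vertex G v" using G(2) by (simp add: nonseparable_def)
  ultimately show "reachable (induced G (verts G - {v})) x y"
    using xy assms(3) unfolding separating_vertex_def remove_vertex_induced[OF G(1)] by blast
qed

lemma connected_reachable:
  "connected_graph G \<Longrightarrow> x \<in> verts G \<Longrightarrow> y \<in> verts G \<Longrightarrow> reachable G x y"
  by (simp add: connected_graph_def)

lemma nonseparable_connected: "nonseparable G \<Longrightarrow> connected_graph G"
  by (simp add: nonseparable_def)

lemma connected_graphI:
  assumes "y \<in> verts G" "\<And>z. z \<in> verts G \<Longrightarrow> reachable G z y"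
  shows "connected_graph G"
  unfolding connected_graph_def using assms reachable_sym reachable_trans by (metis empty_iff)

subsection \<open>Uncolorable list assignments of nonseparable graphs\<close>

text \<open>Precolor \<open>v\<close> alone with \<open>c\<close>. That the forbidden color lies in
  the list of \<open>w\<close> makes \<open>L v\<close> map into \<open>L w\<close> under the sign
  of the edge; that parallel edges forbid different colors excludes parallel edges of equal sign,
  and the color 0 next to a doubled edge.\<close>

lemma bad_lists_color_vertex:
  assumes G: "signed_graph G" "nonseparable G" and bad: "bad_lists G L"
    and e: "e \<in> edges G" "ends G e = {v, w}" and c: "c \<in> L v"
  shows bad_lists_edge: "esign G e * c \<in> L w"
    and bad_lists_parallel:
      "\<And>e'. e' \<in> edges G \<Longrightarrow> ends G e' = {v, w} \<Longrightarrow> e \<noteq> e' \<Longrightarrow> esign G e * c \<noteq> esign G e' * c"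
proof -
  have vw: "v \<in> verts G" "w \<in> verts G" "v \<noteq> w"
    using signed_graphD(1)[OF G(1) e(1)] e edge_ends_neq[OF G(1) e] by auto
  let ?U = "verts G - {v}"
  have W: "verts G - ?U = {v}" using vw by auto
  have "list_coloring (induced G {v}) L (\<lambda>_. c)"
  proof -
    have "\<not> ends G e \<subseteq> {v}" if "e \<in> edges G" for e
      using card_mono[of "{v}" "ends G e"] signed_graphD(2)[OF G(1) that] by auto
    then show ?thesis using c by (auto simp: list_coloring_def coloring_def)
  qed
  then have \<phi>: "list_coloring (induced G (verts G - ?U)) L (\<lambda>_. c)" unfolding W .
  have conn: "connected_graph (induced G ?U)" by (rule nonseparable_remove[OF G vw])
  have w: "w \<in> ?U" using vw by auto
  note t = forbidden_tight[OF G(1) bad _ conn \<phi> w]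
  have e': "ends G e = {w, v}" using e by auto
  have "esign G e * c \<in> forbidden G (verts G - ?U) (\<lambda>_. c) w"
    unfolding forbidden_def W using e' e(1) by blast
  then show "esign G e * c \<in> L w" using t(1) by blast
  show "esign G e * c \<noteq> esign G e2 * c" if "e2 \<in> edges G" "ends G e2 = {v, w}" "e \<noteq> e2" for e2
    using t(2)[of e e2 v v] that e e' W by (auto simp: insert_commute)
qed

text \<open>\<open>u\<close> and \<open>w\<close> receive the colors that make both edges at
  \<open>v\<close> forbid \<open>a\<close>. With the rest connected this contradicts tightness, so
  the two colors must clash with each other, which only an edge \<open>u w\<close> of the right sign
  can cause.\<close>

lemma bad_lists_triangle:
  assumes G: "signed_graph G" "nonseparable G" and bad: "bad_lists G L"
    and e1: "e1 \<in> edges G" "ends G e1 = {v, u}" and e2: "e2 \<in> edges G" "ends G e2 = {v, w}"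
    and uw: "u \<noteq> w" and conn: "connected_graph (induced G (verts G - {u, w}))" and a: "a \<in> L v"
  shows "\<exists>e3\<in>edges G. ends G e3 = {u, w} \<and> esign G e1 * a = esign G e3 * (esign G e2 * a)"
proof (rule ccontr)
  assume none: "\<not> ?thesis"
  let ?U = "verts G - {u, w}"
  let ?\<phi> = "\<lambda>z. if z = u then esign G e1 * a else esign G e2 * a"
  have mem: "u \<in> verts G" "w \<in> verts G" "v \<in> verts G" "v \<noteq> u" "v \<noteq> w"
    using signed_graphD(1)[OF G(1)] e1 e2 edge_ends_neq[OF G(1)] by auto
  then have W: "verts G - ?U = {u, w}" by auto
  have "?\<phi> s \<noteq> esign G e * ?\<phi> t" if e: "e \<in> edges G" "ends G e \<subseteq> {u, w}" "ends G e = {s, t}" for e s t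
  proof -
    have "s \<noteq> t" using edge_ends_neq[OF G(1) e(1,3)] .
    then have "ends G e = {u, w}" "s = u \<and> t = w \<or> s = w \<and> t = u" using e by auto
    then show ?thesis using none e(1) uw sign_swap[OF signed_graphD(3)[OF G(1) e(1)]] by auto
  qed
  then have "coloring (induced G {u, w}) ?\<phi>"
    unfolding coloring_def induced_simps by blast
  then have \<phi>: "list_coloring (induced G (verts G - ?U)) L ?\<phi>"
    unfolding W list_coloring_def
    using bad_lists_edge[OF G bad e1 a] bad_lists_edge[OF G bad e2 a] by auto
  have sq: "esign G e * esign G e = 1" if "e \<in> edges G" for e
    using signed_graphD(3)[OF G(1) that] by auto
  have v: "v \<in> ?U" using mem by auto
  have "e1 \<noteq> e2" using e1 e2 uw by (auto simp: doubleton_eq_iff)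
  then have "esign G e1 * ?\<phi> u \<noteq> esign G e2 * ?\<phi> w"
    using forbidden_tight(2)[OF G(1) bad _ conn \<phi> v, of e1 e2 u w] e1 e2 W by auto
  moreover have "esign G e1 * ?\<phi> u = a" "esign G e2 * ?\<phi> w = a"
    using sq[OF e1(1)] sq[OF e2(1)] uw by (simp_all flip: mult.assoc)
  ultimately show False by simp
qed

subsection \<open>Separating pairs\<close>

text \<open>Stands in for the choice of a non-cut vertex in an end block: \<open>C\<close> is a
  component of \<open>G\<close> minus \<open>x\<close> and \<open>y\<close>, and \<open>u\<close>
  can be deleted without cutting any other vertex of \<open>C\<close> off from
  \<open>y\<close>.\<close>

lemma component_neighbour:
  assumes G: "signed_graph G" "nonseparable G"
    and xy: "x \<in> verts G" "y \<in> verts G" "x \<noteq> y" and c: "c \<in> verts G - {x, y}"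
    and C: "C = {z. reachable (induced G (verts G - {x, y})) c z}"
  shows "\<exists>u\<in>C. adjacent G x u \<and> (\<forall>z\<in>C - {u}. reachable (induced G (insert y C - {u})) z y)"
proof -
  have Gxy: "signed_graph (induced G (verts G - {x, y}))" using G by simp
  have CV: "C \<subseteq> verts G - {x, y}" unfolding C using reachable_verts[OF Gxy] c by auto
  have finC: "finite C" using CV G(1) by (auto simp: signed_graph_def intro: finite_subset)
  have cC: "c \<in> C" unfolding C by simp
  have closed: "t \<in> C \<or> t = x \<or> t = y" if "s \<in> C" "adjacent G s t" for s t
  proof (rule ccontr)
    assume n: "\<not> ?thesis"
    moreover have "t \<in> verts G" "s \<in> verts G - {x, y}" using that adjacentD(2)[OF G(1) that(2)] CV by auto
    ultimately have "adjacent (induced G (verts G - {x, y})) s t" using that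
      by (auto simp: adjacent_induced)
    then have "t \<in> C" using that(1) reachable_step unfolding C by fastforce
    then show False using n by simp
  qed
  \<comment> \<open>If some part of \<open>C\<close> were cut off from \<open>y\<close> by a neighbour \<open>u\<close> of \<open>x\<close>, it would contain another
    neighbour of \<open>x\<close>, as \<open>u\<close> does not separate \<open>G\<close>; so a neighbour with \<open>A u\<close> of maximal size works.\<close>
  define A where "A u = {z \<in> C - {u}. reachable (induced G (insert y C - {u})) z y}" for u
  let ?N = "{u \<in> C. adjacent G x u}"
  \<comment> \<open>\<open>y\<close> alone does not separate \<open>c\<close> from \<open>x\<close>,
    so \<open>C\<close> has an edge to \<open>x\<close>.\<close>
  have "?N \<noteq> {}"
  proof -
    have "connected_graph (induced G (verts G - {y}))"
      using nonseparable_remove[OF G xy(2,1)] xy by simp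
    then have "reachable (induced G (verts G - {y})) c x"
      using c xy by (intro connected_reachable) auto
    then obtain s t where "s \<in> C" "t \<notin> C" "adjacent (induced G (verts G - {y})) s t"
      using reachable_cut[of _ c x C] cC CV by blast
    then show ?thesis using closed by (auto simp: adjacent_induced adjacent_sym)
  qed
  then have "Max ((\<lambda>u. card (A u)) ` ?N) \<in> (\<lambda>u. card (A u)) ` ?N"
    using finC by (intro Max_in) auto
  then obtain u where u: "u \<in> ?N" "card (A u) = Max ((\<lambda>u. card (A u)) ` ?N)" by auto
  have max: "card (A k) \<le> card (A u)" if "k \<in> ?N" for k
    unfolding u(2) using that finC by (intro Max_ge) auto
  have yC: "y \<notin> C" "x \<notin> C" using CV by auto
  have uV: "u \<in> verts G" "u \<noteq> x" "u \<noteq> y" "u \<in> C" "adjacent G x u" using u(1) CV yC by auto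
  have "z \<in> A u" if z: "z \<in> C - {u}" for z
  proof (rule ccontr)
    assume "z \<notin> A u"
    let ?H = "induced G (insert y C - {u})"
    have H: "signed_graph ?H" using G(1) CV xy by (intro signed_graph_induced) auto
    \<comment> \<open>The part cut off from \<open>y\<close> together with \<open>z\<close>. Since
      \<open>u\<close> does not separate \<open>G\<close>, this part has an edge to
      \<open>x\<close>, whose end \<open>k\<close> in the part is a competitor of
      \<open>u\<close>.\<close>
    let ?K = "{k. reachable ?H z k}"
    have yK: "y \<notin> ?K" using z \<open>z \<notin> A u\<close> unfolding A_def by simp
    have KC: "?K \<subseteq> C - {u}"
    proof
      fix k assume k: "k \<in> ?K"
      have "z \<in> verts ?H" using z by simp
      then have "k \<in> verts ?H" using reachable_verts[OF H, of z k] k by simp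
      moreover have "k \<noteq> y" using k yK by blast
      ultimately show "k \<in> C - {u}" by simp
    qed
    have "connected_graph (induced G (verts G - {u}))"
      using nonseparable_remove[OF G uV(1) xy(2)] uV(3) by simp
    moreover have "z \<in> verts G - {u}" "x \<in> verts G - {u}" using z CV xy uV by auto
    ultimately have "reachable (induced G (verts G - {u})) z x"
      by (intro connected_reachable) simp_all
    moreover have "z \<in> ?K" "x \<notin> ?K" using KC yC by auto
    ultimately obtain k k' where k: "k \<in> ?K" "k' \<notin> ?K" "adjacent (induced G (verts G - {u})) k k'"
      using reachable_cut[of _ z x ?K] by blast
    then have kC: "k \<in> C - {u}" "adjacent G k k'" "k' \<noteq> u" using KC by (auto simp: adjacent_induced)
    have "k' \<notin> insert y C"
    proof
      assume "k' \<in> insert y C"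
      then have "adjacent ?H k k'" using kC by (auto simp: adjacent_induced)
      then show False using k(1,2) reachable_step by fastforce
    qed
    then have "k' = x" using closed[of k k'] kC by auto
    then have kN: "k \<in> ?N" using kC adjacent_sym by fastforce
    have nky: "\<not> reachable ?H k y"
      using k(1) yK reachable_trans[of ?H z k y] by blast
    \<comment> \<open>No walk to \<open>y\<close> in \<open>?H\<close> meets \<open>k\<close>,
      because \<open>k\<close> cannot reach \<open>y\<close> there; so such walks survive when
      \<open>k\<close> is deleted instead of \<open>u\<close>.\<close>
    have path: "reachable (induced G (insert y C - {k})) a y" if ay: "reachable ?H a y" and ak: "a \<noteq> k" for a
    proof -
      let ?S = "{s. reachable (induced G (insert y C - {k})) a s}"
      have "y \<in> ?S"
      proof (rule ccontr)
        assume "y \<notin> ?S"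
        then have "a \<in> ?S \<inter> {s. reachable ?H a s}" "y \<notin> ?S \<inter> {s. reachable ?H a s}" by simp_all
        then obtain s t where st: "s \<in> ?S \<inter> {s. reachable ?H a s}" "t \<notin> ?S \<inter> {s. reachable ?H a s}" "adjacent ?H s t"
          using reachable_cut[OF ay, of "?S \<inter> {s. reachable ?H a s}"] by blast
        have ra: "reachable ?H a t" using st(1) reachable_step[OF _ st(3)] by simp
        have "reachable ?H t y" using reachable_trans[OF reachable_sym[OF ra] ay] .
        then have tk: "t \<noteq> k" using nky by blast
        have "reachable ?H s y" using st(1) reachable_trans[OF reachable_sym ay] by simp
        then have "s \<noteq> k" using nky by blast
        then have "adjacent (induced G (insert y C - {k})) s t"
          using st(3) tk by (auto simp: adjacent_induced)
        moreover have "reachable (induced G (insert y C - {k})) a s" using st(1) by simp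
        ultimately have "t \<in> ?S" using reachable_step by (intro CollectI)
        then show False using st(2) ra by simp
      qed
      then show ?thesis by simp
    qed
    have "A u \<subseteq> A k"
    proof
      fix a assume a: "a \<in> A u"
      then have "reachable ?H a y" "a \<in> C" by (auto simp: A_def)
      moreover have "a \<noteq> k" using calculation nky by blast
      ultimately show "a \<in> A k" using path[of a] by (simp add: A_def)
    qed
    moreover have "u \<in> A k"
    proof -
      \<comment> \<open>Leaving this set without passing \<open>x\<close> is possible only from
        \<open>u\<close>: any other vertex of it with a neighbour that reaches \<open>y\<close> in
        \<open>?H\<close> would itself be in \<open>A u\<close>. So \<open>u\<close> reaches
        \<open>y\<close> when \<open>k\<close> is deleted instead, and \<open>A k\<close> is
        strictly larger than \<open>A u\<close>.\<close>
      let ?T = "C - A u"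
      have "connected_graph (induced G (verts G - {x}))"
        using nonseparable_remove[OF G xy] by simp
      then have "reachable (induced G (verts G - {x})) u y"
        using xy uV by (intro connected_reachable) simp_all
      moreover have "u \<in> ?T" "y \<notin> ?T" using uV yC by (auto simp: A_def)
      ultimately obtain s t where st: "s \<in> ?T" "t \<notin> ?T" "adjacent (induced G (verts G - {x})) s t"
        using reachable_cut[of _ u y ?T] by blast
      then have t: "t = y \<or> t \<in> A u" "adjacent G s t" using closed[of s t] by (auto simp: adjacent_induced)
      have ty: "reachable ?H t y" using t(1) by (auto simp: A_def)
      have tu: "t \<noteq> u" "t \<in> insert y C" using t(1) u yC by (auto simp: A_def)
      have "s = u"
      proof (rule ccontr)
        assume "s \<noteq> u"
        then have "adjacent ?H s t" using st(1) t(2) tu by (auto simp: adjacent_induced)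
        then have "reachable ?H s y" using ty reachable_adjacent reachable_trans by metis
        then show False using st(1) \<open>s \<noteq> u\<close> by (simp add: A_def)
      qed
      have "t \<noteq> k" using ty nky by blast
      then have "reachable (induced G (insert y C - {k})) t y" using path ty by simp
      moreover have "adjacent (induced G (insert y C - {k})) u t"
        using t(2) \<open>s = u\<close> \<open>t \<noteq> k\<close> tu kC u by (auto simp: adjacent_induced)
      ultimately show ?thesis using u kC reachable_adjacent reachable_trans unfolding A_def by fastforce
    qed
    moreover have "u \<notin> A u" "finite (A k)" using finC by (auto simp: A_def)
    ultimately have "card (A u) < card (A k)" by (metis psubsetI psubset_card_mono)
    then show False using max[OF kN] by simp
  qed
  then show ?thesis using u unfolding A_def by (intro bexI[of _ u]) auto
qed

text \<open>One neighbour of \<open>x\<close> is taken from each of two components by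
  \<open>component_neighbour\<close>; lying in different components they are not adjacent. After
  deleting both, every vertex except possibly \<open>x\<close> still reaches \<open>y\<close>, and
  \<open>x\<close> does as soon as it has a third neighbour.\<close>

lemma separating_pair_neighbours:
  assumes G: "signed_graph G" "nonseparable G"
    and xy: "x \<in> verts G" "y \<in> verts G" "x \<noteq> y"
    and ab: "a \<in> verts G - {x, y}" "b \<in> verts G - {x, y}"
      "\<not> reachable (induced G (verts G - {x, y})) a b"
  obtains u w where "u \<noteq> w" "{z. adjacent G x z} = {u, w}"
  | u w where "u \<noteq> w" "adjacent G x u" "adjacent G x w" "\<not> adjacent G u w"
      "connected_graph (induced G (verts G - {u, w}))"
proof -
  let ?R = "reachable (induced G (verts G - {x, y}))"
  define comp where "comp c = {z. ?R c z}" for c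
  have sg: "signed_graph (induced G (verts G - {x, y}))" using G by simp
  have compV: "comp c \<subseteq> verts G - {x, y}" if "c \<in> verts G - {x, y}" for c
    unfolding comp_def using reachable_verts[OF sg] that by auto
  obtain u where u: "u \<in> comp a" "adjacent G x u"
    "\<And>z. z \<in> comp a - {u} \<Longrightarrow> reachable (induced G (insert y (comp a) - {u})) z y"
    using component_neighbour[OF G xy ab(1) comp_def] by blast
  obtain w where w: "w \<in> comp b" "adjacent G x w"
    "\<And>z. z \<in> comp b - {w} \<Longrightarrow> reachable (induced G (insert y (comp b) - {w})) z y"
    using component_neighbour[OF G xy ab(2) comp_def] by blast
  have disj: "comp a \<inter> comp b = {}"
    using ab(3) reachable_trans reachable_sym unfolding comp_def by fast
  have uw: "u \<noteq> w" using u w disj by blast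
  show thesis
  proof (cases "{z. adjacent G x z} = {u, w}")
    case True
    then show ?thesis using that(1)[OF uw] by blast
  next
    case False
    then obtain t where t: "adjacent G x t" "t \<noteq> u" "t \<noteq> w" using u w by blast
    have "\<not> adjacent G u w"
    proof
      assume "adjacent G u w"
      then have "adjacent (induced G (verts G - {x, y})) u w"
        using u w compV ab by (auto simp: adjacent_induced)
      then have "w \<in> comp a" using u(1) reachable_step unfolding comp_def by fastforce
      then show False using w disj by blast
    qed
    let ?U = "verts G - {u, w}"
    let ?H = "induced G ?U"
    have mono: "reachable ?H z y"
      if "reachable (induced G S) z y" "S \<subseteq> ?U" for S z
      using that(1) by (rule reachable_mono) (use that(2) in \<open>auto simp: adjacent_induced\<close>)
    have ny: "y \<noteq> u" "y \<noteq> w" "x \<noteq> u" "x \<noteq> w" using u w compV ab by auto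
    have ztoy: "reachable ?H z y" if z: "z \<in> ?U - {x}" for z
    proof (cases "z = y")
      case zy: False
      then have z': "z \<in> verts G - {x, y}" using z by auto
      consider "z \<in> comp a" | "z \<in> comp b" | "comp z \<inter> comp a = {}" "comp z \<inter> comp b = {}"
        using reachable_trans reachable_sym unfolding comp_def by fast
      then show ?thesis
      proof cases
        case 1
        then show ?thesis using u(3)[of z] z compV[OF ab(1)] w disj ny xy by (intro mono) auto
      next
        case 2
        then show ?thesis using w(3)[of z] z compV[OF ab(2)] u disj ny xy by (intro mono) auto
      next
        case 3
        \<comment> \<open>A component containing neither \<open>u\<close> nor \<open>w\<close> is
          untouched, and it has an edge to \<open>y\<close> because \<open>x\<close> alone does not
          separate.\<close>
        have sub: "insert y (comp z) \<subseteq> ?U" using 3 u w compV[OF z'] ny xy by auto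
        have "connected_graph (induced G (verts G - {x}))"
          using nonseparable_remove[OF G xy] by simp
        then have "reachable (induced G (verts G - {x})) z y"
          using xy z' by (intro connected_reachable) auto
        moreover have "z \<in> comp z" "y \<notin> comp z" using compV[OF z'] by (auto simp: comp_def)
        ultimately obtain s s' where s: "s \<in> comp z" "s' \<notin> comp z" "adjacent (induced G (verts G - {x})) s s'"
          using reachable_cut[of _ z y "comp z"] by blast
        have "s' = y"
        proof (rule ccontr)
          assume "s' \<noteq> y"
          then have "adjacent (induced G (verts G - {x, y})) s s'"
            using s compV[OF z'] by (auto simp: adjacent_induced)
          then show False using s(1,2) reachable_step unfolding comp_def by fastforce
        qed
        then have sy: "adjacent ?H s y" using s sub by (auto simp: adjacent_induced)
        have "reachable ?H z s"
        proof (rule ccontr)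
          assume n: "\<not> reachable ?H z s"
          have "?R z s" using s(1) by (simp add: comp_def)
          then obtain p q where pq: "p \<in> comp z \<inter> {p. reachable ?H z p}" "q \<notin> comp z \<inter> {p. reachable ?H z p}"
            "adjacent (induced G (verts G - {x, y})) p q"
            using reachable_cut[of _ z s "comp z \<inter> {p. reachable ?H z p}"] n
            by (metis (no_types, lifting) IntI Int_iff comp_def mem_Collect_eq reachable_refl)
          then have q: "q \<in> comp z" using reachable_step unfolding comp_def by fastforce
          then have "adjacent ?H p q" using pq sub by (auto simp: adjacent_induced)
          then show False using pq q reachable_step by fastforce
        qed
        then show ?thesis using reachable_step sy by metis
      qed
    qed simp
    have "reachable ?H z y" if z: "z \<in> ?U" for z
    proof (cases "z = x")
      case True
      \<comment> \<open>The third neighbour \<open>t\<close> may be \<open>y\<close> itself or lie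
        in any component.\<close>
      have tU: "t \<in> ?U - {x}" using t(2,3) adjacentD(2,3)[OF G(1) t(1)] by simp
      have "adjacent ?H x t" using t(1) tU xy ny by (simp add: adjacent_induced)
      then show ?thesis using reachable_trans[OF reachable_adjacent ztoy[OF tU]] True by simp
    next
      case False
      then show ?thesis using z ztoy by simp
    qed
    then have "connected_graph ?H"
      using xy ny by (intro connected_graphI[of y]) auto
    then show ?thesis using that(2)[OF uw u(2) w(2) \<open>\<not> adjacent G u w\<close>] by blast
  qed
qed

subsection \<open>Cycles and potentials\<close>

text \<open>\<open>coloring\<close> demands the condition for both orientations of an edge; one is
  enough since a sign is its own inverse.\<close>

lemma coloringI:
  assumes G: "signed_graph G"
    and "\<And>e. e \<in> edges G \<Longrightarrow> \<exists>v w. ends G e = {v, w} \<and> \<phi> v \<noteq> esign G e * \<phi> w"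
  shows "coloring G \<phi>"
  unfolding coloring_def
proof (intro ballI allI impI)
  fix e v w assume e: "e \<in> edges G" "ends G e = {v, w}"
  obtain p q where "ends G e = {p, q}" "\<phi> p \<noteq> esign G e * \<phi> q" using assms(2)[OF e(1)] by blast
  then show "\<phi> v \<noteq> esign G e * \<phi> w"
    using e(2) sign_swap[OF signed_graphD(3)[OF G e(1)]] by (metis doubleton_eq_iff)
qed

lemma doubledI:
  assumes "verts G = V" "\<And>e. e \<in> edges G \<Longrightarrow> ends G e \<in> F"
    and "\<And>f s. f \<in> F \<Longrightarrow> s \<in> {1, -1} \<Longrightarrow> \<exists>e\<in>edges G. ends G e = f \<and> esign G e = s"
    and "\<And>e e'. e \<in> edges G \<Longrightarrow> e' \<in> edges G \<Longrightarrow> ends G e = ends G e' \<Longrightarrow> esign G e = esign G e' \<Longrightarrow> e = e'"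
  shows "doubled G V F"
proof -
  have "bij_betw (ends G) {e \<in> edges G. esign G e = s} F" if s: "s \<in> {1, -1}" for s
    unfolding bij_betw_def
  proof
    show "inj_on (ends G) {e \<in> edges G. esign G e = s}"
      by (rule inj_onI) (use assms(4) in auto)
    show "ends G ` {e \<in> edges G. esign G e = s} = F"
      using assms(2) assms(3)[OF _ s] by fast
  qed
  then show ?thesis using assms(1) by (simp add: doubled_def)
qed

lemma underlying_simpleI:
  assumes "verts G = V" "\<And>e. e \<in> edges G \<Longrightarrow> ends G e \<in> F"
    and "\<And>f. f \<in> F \<Longrightarrow> \<exists>e\<in>edges G. ends G e = f"
    and "\<And>e e'. e \<in> edges G \<Longrightarrow> e' \<in> edges G \<Longrightarrow> ends G e = ends G e' \<Longrightarrow> e = e'"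
  shows "underlying_simple G V F"
  using assms unfolding underlying_simple_def bij_betw_def inj_on_def by fast

section \<open>Signs along a cycle\<close>

lemma Suc_mod_cases: "i < n \<Longrightarrow> Suc i mod n = (if Suc i = n then 0 else Suc i)"
  by auto

text \<open>Rotation of the indices; it turns a product over successors along a cycle into the
  product over the vertices.\<close>

lemma bij_betw_Suc_mod: "bij_betw (\<lambda>i. Suc i mod n) {..<n} {..<n}"
proof -
  have inj: "inj_on (\<lambda>i. Suc i mod n) {..<n}"
    by (rule inj_onI) (auto simp: Suc_mod_cases split: if_splits)
  moreover have "(\<lambda>i. Suc i mod n) ` {..<n} \<subseteq> {..<n}" by auto
  ultimately show ?thesis by (simp add: bij_betw_def endo_inj_surj)
qed

lemma sign_product_cycle:
  assumes "distinct es" "length es = n" "edges G = set es"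
  shows "sign_product G = (\<Prod>i<n. esign G (es ! i))"
proof -
  have "bij_betw (\<lambda>i. es ! i) {..<n} (edges G)"
    using bij_betw_nth[OF assms(1), of "{..<n}" "set es"] assms by simp
  from prod.reindex_bij_betw[OF this, of "esign G"] show ?thesis
    by (simp add: sign_product_def)
qed

text \<open>A potential: switching at the vertices with \<open>s v = -1\<close> makes all edges
  positive. In the sign product of a cycle every vertex sign occurs twice, so the product is a
  nonzero square.\<close>

lemma potential_balanced:
  assumes s: "\<And>v. v \<in> verts G \<Longrightarrow> s v = 1 \<or> s v = (-1::int)"
    and pot: "\<And>e. e \<in> edges G \<Longrightarrow> \<exists>v w. ends G e = {v, w} \<and> esign G e = s v * s w"
  shows "balanced G"
  unfolding balanced_def
proof (intro allI impI)
  fix C n assume "subgraph C G \<and> cycle_graph n C"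
  then have C: "subgraph C G" "cycle_graph n C" by auto
  then obtain vs es where n: "n \<ge> 2" "length vs = n" "length es = n" "distinct vs" "distinct es"
    "verts C = set vs" "edges C = set es"
    "\<And>i. i < n \<Longrightarrow> ends C (es ! i) = {vs ! i, vs ! (Suc i mod n)}"
    by (auto simp: cycle_graph_def)
  have pot': "esign G e = s v * s w" if "e \<in> edges G" "ends G e = {v, w}" for e v w
    using pot[OF that(1)] that(2) by (auto simp: doubleton_eq_iff)
  have e: "esign C (es ! i) = s (vs ! i) * s (vs ! (Suc i mod n))" if i: "i < n" for i
  proof -
    have "es ! i \<in> edges G" using C(1) n i by (auto simp: subgraph_def)
    then show ?thesis using pot'[of "es ! i"] n(8)[OF i] C(1) by (simp add: subgraph_def)
  qed
  have "sign_product C = (\<Prod>i<n. s (vs ! i)) * (\<Prod>i<n. s (vs ! (Suc i mod n)))"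
    unfolding sign_product_cycle[OF n(5,3,7)] prod.distrib[symmetric] using e by (intro prod.cong) auto
  also have "(\<Prod>i<n. s (vs ! (Suc i mod n))) = (\<Prod>i<n. s (vs ! i))"
    by (rule prod.reindex_bij_betw[OF bij_betw_Suc_mod])
  finally have "sign_product C = (\<Prod>i<n. s (vs ! i)) ^ 2" by (simp add: power2_eq_square)
  moreover have "(\<Prod>i<n. s (vs ! i)) \<noteq> 0"
  proof -
    have "s (vs ! i) \<noteq> 0" if "i < n" for i
    proof -
      have "vs ! i \<in> verts G" using that n C(1) by (auto simp: subgraph_def)
      then show ?thesis using s[of "vs ! i"] by auto
    qed
    then show ?thesis by simp
  qed
  ultimately show "sign_product C > 0" by simp
qed

lemma ex_fun_nth:
  assumes "distinct vs"
  shows "\<exists>f. \<forall>i<length vs. f (vs ! i) = g i"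
proof -
  have "inj_on ((!) vs) {..<length vs}" using assms by (auto simp: inj_on_def nth_eq_iff_index_eq)
  then have "\<forall>i<length vs. g (inv_into {..<length vs} ((!) vs) (vs ! i)) = g i"
    by (simp add: inv_into_f_f)
  then show ?thesis by (rule exI[of _ "\<lambda>v. g (inv_into {..<length vs} ((!) vs) v)"])
qed

lemma prod_sign:
  fixes f :: "nat \<Rightarrow> int"
  shows "(\<And>i. i < n \<Longrightarrow> f i = 1 \<or> f i = -1) \<Longrightarrow> (\<Prod>i<n. f i) = 1 \<or> (\<Prod>i<n. f i) = -1"
proof (induction n)
  case (Suc n)
  have "(\<Prod>i<n. f i) = 1 \<or> (\<Prod>i<n. f i) = -1" using Suc.prems by (intro Suc.IH) simp
  moreover have "f n = 1 \<or> f n = -1" using Suc.prems[of n] by simp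
  ultimately show ?case by auto
qed simp

text \<open>A cycle contains itself, which gives one direction. For the other, the partial products
  of signs along the list form a potential, consistent at the closing edge exactly when the whole
  product is 1.\<close>

lemma cycle_balanced_iff:
  assumes G: "signed_graph G" and n: "n \<ge> 2" "length vs = n" "length es = n" "distinct vs" "distinct es"
    "verts G = set vs" "edges G = set es"
    "\<And>i. i < n \<Longrightarrow> ends G (es ! i) = {vs ! i, vs ! (Suc i mod n)}"
  shows "balanced G \<longleftrightarrow> (\<Prod>i<n. esign G (es ! i)) = 1"
proof
  assume "balanced G"
  moreover have "subgraph G G" using G by (simp add: subgraph_def)
  moreover have "cycle_graph n G" using n unfolding cycle_graph_def by blast
  ultimately have "sign_product G > 0" by (auto simp: balanced_def)
  moreover have "(\<Prod>i<n. esign G (es ! i)) = 1 \<or> (\<Prod>i<n. esign G (es ! i)) = -1"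
    using signed_graphD(3)[OF G] n by (intro prod_sign) auto
  ultimately show "(\<Prod>i<n. esign G (es ! i)) = 1"
    using sign_product_cycle[OF n(5,3,7)] by auto
next
  assume P: "(\<Prod>i<n. esign G (es ! i)) = 1"
  define S where "S i = (\<Prod>j<i. esign G (es ! j))" for i
  obtain s where s: "\<And>i. i < n \<Longrightarrow> s (vs ! i) = S i"
    using ex_fun_nth[OF n(4), of S] n(2) by blast
  have sgn: "esign G (es ! i) = 1 \<or> esign G (es ! i) = -1" if "i < n" for i
    using signed_graphD(3)[OF G] n that by auto
  have S1: "S i = 1 \<or> S i = -1" if "i \<le> n" for i
    unfolding S_def using sgn that by (intro prod_sign) auto
  have Sstep: "S (Suc i mod n) = S i * esign G (es ! i)" if "i < n" for i
    using that P by (auto simp: Suc_mod_cases S_def)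
  show "balanced G"
  proof (rule potential_balanced[of G s])
    fix v assume "v \<in> verts G"
    then obtain i where "i < n" "v = vs ! i" using n by (auto simp: in_set_conv_nth)
    then show "s v = 1 \<or> s v = -1" using s S1[of i] by simp
  next
    fix e assume "e \<in> edges G"
    then obtain i where i: "i < n" "e = es ! i" using n by (auto simp: in_set_conv_nth)
    moreover have "Suc i mod n < n" using n by simp
    ultimately have "esign G e = s (vs ! i) * s (vs ! (Suc i mod n))"
      using s Sstep[OF i(1)] S1[of i] by auto
    then show "\<exists>v w. ends G e = {v, w} \<and> esign G e = s v * s w" using n(8) i by blast
  qed
qed

section \<open>Graphs in which every vertex has two neighbours\<close>

lemma card2_third: "card S = 2 \<Longrightarrow> a \<in> S \<Longrightarrow> b \<in> S \<Longrightarrow> a \<noteq> b \<Longrightarrow> c \<in> S \<Longrightarrow> c = a \<or> c = b"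
  by (auto simp: card_2_iff)

text \<open>For length 2 the two edges of the list would have the same ends, hence
  \<open>n \<ge> 3\<close>.\<close>

lemma cycle_edges_inj:
  assumes "distinct vs" "length vs = n" "n \<ge> 3" "i < n" "j < n"
    "{vs ! i, vs ! (Suc i mod n)} = {vs ! j, vs ! (Suc j mod n)}"
  shows "i = j"
proof -
  have "Suc i mod n < n" "Suc j mod n < n" using assms by auto
  then have "i = j \<or> i = Suc j mod n \<and> j = Suc i mod n"
    using assms by (auto simp: doubleton_eq_iff nth_eq_iff_index_eq)
  then show ?thesis using assms by (auto simp: Suc_mod_cases split: if_splits)
qed

text \<open>In a longest path both neighbours of the last vertex lie on the path. The one further
  back must be the first vertex, since an inner one would have a third neighbour. The closed path
  uses up both neighbours of each of its vertices, so connectedness puts every vertex on it.\<close>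

lemma two_regular_cycle:
  assumes G: "signed_graph G" "connected_graph G"
    and two: "\<And>v. v \<in> verts G \<Longrightarrow> card {w. adjacent G v w} = 2"
  obtains vs where "distinct vs" "set vs = verts G" "length vs \<ge> 3"
    "\<And>x y. adjacent G x y \<longleftrightarrow> {x, y} \<in> cycle_edges vs"
proof -
  let ?P = "\<lambda>vs. vs \<noteq> [] \<and> distinct vs \<and> set vs \<subseteq> verts G \<and>
    (\<forall>i. Suc i < length vs \<longrightarrow> adjacent G (vs ! i) (vs ! Suc i))"
  have finV: "finite (verts G)" using G by (simp add: signed_graph_def)
  obtain v0 where "v0 \<in> verts G" using G by (auto simp: connected_graph_def)
  then have "?P [v0]" by simp
  moreover have "\<forall>vs. ?P vs \<longrightarrow> length vs < Suc (card (verts G))"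
    using finV by (metis card_mono distinct_card less_Suc_eq_le)
  ultimately obtain vs where P: "?P vs" and max: "\<And>ws. ?P ws \<Longrightarrow> length ws \<le> length vs"
    using ex_has_greatest_nat[of ?P "[v0]" length "Suc (card (verts G))"] by (metis less_imp_le_nat)
  define n where "n = length vs"
  have n0: "n > 0" using P by (simp add: n_def)
  have path: "adjacent G (vs ! i) (vs ! Suc i)" if "Suc i < n" for i using P that by (simp add: n_def)
  have path': "adjacent G (vs ! Suc i) (vs ! i)" if "Suc i < n" for i
    using path[OF that] adjacent_sym by metis
  have dist: "vs ! i = vs ! j \<longleftrightarrow> i = j" if "i < n" "j < n" for i j
    using P that by (simp add: n_def nth_eq_iff_index_eq)
  have inV: "vs ! i \<in> verts G" if "i < n" for i using P that by (auto simp: n_def)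
  let ?l = "vs ! (n - 1)"
  have inpath: "w \<in> set vs" if w: "adjacent G ?l w" for w
  proof (rule ccontr)
    assume "w \<notin> set vs"
    moreover have "w \<in> verts G" using adjacentD(2)[OF G(1) w] .
    moreover have "adjacent G ((vs @ [w]) ! i) ((vs @ [w]) ! Suc i)" if "Suc i < length (vs @ [w])" for i
    proof (cases "Suc i = n")
      case True
      then have "i = n - 1" "i < n" by auto
      then show ?thesis using w True by (simp add: nth_append n_def)
    next
      case False
      then show ?thesis using path[of i] that by (simp add: nth_append n_def)
    qed
    ultimately have "?P (vs @ [w])" using P by auto
    from max[OF this] show False by simp
  qed
  have "card {w. adjacent G ?l w} = 2" using two inV n0 by simp
  then obtain p q where pq: "{w. adjacent G ?l w} = {p, q}" "p \<noteq> q" by (auto simp: card_2_iff)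
  obtain i j where ij: "i < j" "j < n" "adjacent G ?l (vs ! i)" "adjacent G ?l (vs ! j)"
  proof -
    obtain i j where *: "i < n" "p = vs ! i" "j < n" "q = vs ! j"
      using inpath pq by (metis in_set_conv_nth insertCI mem_Collect_eq n_def)
    then have "i < j \<or> j < i" using pq(2) by (metis linorder_neqE_nat)
    then show thesis using that[of i j] that[of j i] * pq(1) by blast
  qed
  \<comment> \<open>As \<open>i < j < n - 1\<close>, the vertex \<open>vs ! i\<close> is not the
    predecessor of the last one, so its successor on the path differs from
    \<open>?l\<close>.\<close>
  have "j \<noteq> n - 1" using adjacentD(3)[OF G(1) ij(4)] by auto
  then have j: "j < n - 1" using ij by simp
  have "i = 0"
  proof (rule ccontr)
    assume i: "i \<noteq> 0"
    have "card {w. adjacent G (vs ! i) w} = 2" using two inV ij by simp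
    moreover have "adjacent G (vs ! i) (vs ! (i - 1))" using path'[of "i - 1"] i ij by simp
    moreover have "adjacent G (vs ! i) (vs ! Suc i)" using path[of i] ij by simp
    moreover have "adjacent G (vs ! i) ?l" using ij adjacent_sym by metis
    moreover have "vs ! (i - 1) \<noteq> vs ! Suc i" using dist[of "i - 1" "Suc i"] i ij by simp
    ultimately have "?l = vs ! (i - 1) \<or> ?l = vs ! Suc i"
      using card2_third[of "{w. adjacent G (vs ! i) w}" "vs ! (i - 1)" "vs ! Suc i" ?l] by blast
    then show False using dist[of "n - 1" "i - 1"] dist[of "n - 1" "Suc i"] i ij j by auto
  qed
  then have close: "adjacent G ?l (vs ! 0)" using ij by simp
  have n3: "n \<ge> 3" using ij j \<open>i = 0\<close> by simp
  have cyc: "adjacent G (vs ! k) (vs ! (Suc k mod n))" if "k < n" for k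
    using that path[of k] close by (cases "Suc k = n") (auto simp: Suc_mod_cases)
  have nb: "{vs ! k, w} \<in> cycle_edges vs \<and> w \<in> set vs" if k: "k < n" and w: "adjacent G (vs ! k) w" for k w
  proof -
    \<comment> \<open>The cyclic predecessor of \<open>k\<close>; it differs from the successor
      because \<open>n \<ge> 3\<close>.\<close>
    define m where "m = (if k = 0 then n - 1 else k - 1)"
    have m: "m < n" "Suc m mod n = k" "m \<noteq> Suc k mod n"
      using k n3 by (auto simp: Suc_mod_cases m_def)
    have sk: "Suc k mod n < n" using n0 by simp
    have "adjacent G (vs ! m) (vs ! k)" using cyc[OF m(1)] m(2) by simp
    then have "adjacent G (vs ! k) (vs ! m)" by (subst adjacent_sym)
    moreover have "vs ! m \<noteq> vs ! (Suc k mod n)" using dist[OF m(1) sk] m(3) by simp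
    ultimately have "w = vs ! m \<or> w = vs ! (Suc k mod n)"
      using card2_third[OF two[OF inV[OF k]], of "vs ! m" "vs ! (Suc k mod n)" w] cyc[OF k] w by blast
    then show ?thesis
    proof
      assume "w = vs ! m"
      then have "{vs ! k, w} = {vs ! m, vs ! (Suc m mod n)}" unfolding m(2) by auto
      then show ?thesis using m(1) \<open>w = vs ! m\<close> unfolding cycle_edges_def n_def by auto
    next
      assume "w = vs ! (Suc k mod n)"
      then show ?thesis using k sk unfolding cycle_edges_def n_def by auto
    qed
  qed
  have all: "verts G \<subseteq> set vs"
  proof
    fix x assume x: "x \<in> verts G"
    show "x \<in> set vs"
    proof (rule ccontr)
      assume "x \<notin> set vs"
      moreover have "vs ! 0 \<in> set vs" using n0 by (simp add: n_def)
      moreover have "reachable G (vs ! 0) x" using G(2) inV[OF n0] x by (rule connected_reachable)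
      ultimately obtain a b where "a \<in> set vs" "b \<notin> set vs" "adjacent G a b"
        using reachable_cut[of G "vs ! 0" x "set vs"] by blast
      then show False using nb by (metis in_set_conv_nth n_def)
    qed
  qed
  show thesis
  proof (rule that[of vs])
    show "distinct vs" "length vs \<ge> 3" using P n3 by (auto simp: n_def)
    show "set vs = verts G" using P all by blast
    show "adjacent G x y \<longleftrightarrow> {x, y} \<in> cycle_edges vs" for x y
    proof
      assume a: "adjacent G x y"
      then have "x \<in> set vs" using all adjacentD(1)[OF G(1)] by blast
      then show "{x, y} \<in> cycle_edges vs" using nb a by (metis in_set_conv_nth n_def)
    next
      assume "{x, y} \<in> cycle_edges vs"
      then obtain k where k: "k < n" "{x, y} = {vs ! k, vs ! (Suc k mod n)}"
        by (auto simp: cycle_edges_def n_def)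
      then show "adjacent G x y" using cyc[of k] by (simp add: adjacent_def)
    qed
  qed
qed

text \<open>The colors pair off as \<open>c\<close> and \<open>-c\<close>. Applied to the list at an
  end of a doubled edge, this excludes degree 3.\<close>

lemma even_card_symmetric:
  assumes "finite (S :: int set)" "0 \<notin> S" "\<And>c. c \<in> S \<Longrightarrow> -c \<in> S"
  shows "even (card S)"
proof -
  let ?P = "{c \<in> S. c > 0}"
  have eq: "S = ?P \<union> uminus ` ?P"
  proof (intro set_eqI iffI)
    fix c assume c: "c \<in> S"
    then have "c > 0 \<or> -c > 0" using assms(2) by (cases "c = 0") auto
    then show "c \<in> ?P \<union> uminus ` ?P" using c assms(3)[OF c] by (force intro: image_eqI[of _ _ "-c"])
  qed (use assms(3) in auto)
  have "card (?P \<union> uminus ` ?P) = card ?P + card (uminus ` ?P)"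
    using assms(1) by (intro card_Un_disjoint) auto
  moreover have "card (uminus ` ?P) = card ?P" by (intro card_image) (simp add: inj_on_def)
  ultimately have "card S = 2 * card ?P" using arg_cong[OF eq, of card] by linarith
  then show ?thesis by simp
qed

subsection \<open>Nonseparable graphs with bad lists are bricks\<close>

lemma bad_lists_nonempty:
  assumes "signed_graph G" "bad_lists G L" "e \<in> edges G" "v \<in> ends G e"
  shows "\<exists>c. c \<in> L v"
proof -
  have "finite {e \<in> edges G. v \<in> ends G e}" using assms(1) by (simp add: signed_graph_def)
  then have "degree G v > 0" using assms(3,4) unfolding degree_def by (auto simp: card_gt_0_iff)
  moreover have "degree G v \<le> card (L v)"
    using assms signed_graphD(1)[OF assms(1,3)] by (auto simp: bad_lists_def)
  ultimately show ?thesis by (metis card.empty equals0I leD)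
qed

text \<open>Two parallel edges of equal sign would forbid the same color.\<close>

lemma bad_lists_edge_unique:
  assumes G: "signed_graph G" "nonseparable G" and bad: "bad_lists G L"
    and "e \<in> edges G" "e' \<in> edges G" "ends G e = ends G e'" "esign G e = esign G e'"
  shows "e = e'"
proof (rule ccontr)
  assume n: "e \<noteq> e'"
  obtain v w where vw: "ends G e = {v, w}" using signed_graphD(2)[OF G(1) assms(4)] by (auto simp: card_2_iff)
  obtain c where "c \<in> L v" using bad_lists_nonempty[OF G(1) bad assms(4)] vw by blast
  then show False using bad_lists_parallel[OF G bad assms(4) vw _ assms(5)] vw n assms(6,7) by simp
qed

text \<open>Following one of the edges and returning along the other multiplies a color by -1 and
  leads back into the same list. The color 0 at \<open>v\<close> would be forbidden at
  \<open>w\<close> by both edges.\<close>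

lemma bad_lists_double_edge:
  assumes G: "signed_graph G" "nonseparable G" and bad: "bad_lists G L"
    and e: "e \<in> edges G" "ends G e = {v, w}" "e' \<in> edges G" "ends G e' = {v, w}" "e \<noteq> e'"
  shows "esign G e' = - esign G e" "0 \<notin> L v" "\<And>c. c \<in> L v \<Longrightarrow> - c \<in> L v"
proof -
  have "esign G e \<noteq> esign G e'" using bad_lists_edge_unique[OF G bad e(1,3)] e(2,4,5) by metis
  then show s: "esign G e' = - esign G e"
    using signed_graphD(3)[OF G(1) e(1)] signed_graphD(3)[OF G(1) e(3)] by auto
  show "0 \<notin> L v" using bad_lists_parallel[OF G bad e(1,2) _ e(3-5), of 0] by auto
  fix c assume c: "c \<in> L v"
  have "esign G e' * (esign G e * c) \<in> L v"
    using bad_lists_edge[OF G bad e(3), of w v] bad_lists_edge[OF G bad e(1,2) c] e(4)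
    by (simp add: insert_commute)
  moreover have "esign G e' * (esign G e * c) = -c"
    using s signed_graphD(3)[OF G(1) e(1)] by auto
  ultimately show "- c \<in> L v" by simp
qed

lemma card_edges_between_le:
  assumes G: "signed_graph G" "nonseparable G" and bad: "bad_lists G L"
  shows "card {e \<in> edges G. ends G e = {v, w}} \<le> 2"
proof -
  have "inj_on (esign G) {e \<in> edges G. ends G e = {v, w}}"
    by (rule inj_onI) (use bad_lists_edge_unique[OF G bad] in auto)
  moreover have "esign G ` {e \<in> edges G. ends G e = {v, w}} \<subseteq> {1, -1}"
    using signed_graphD(3)[OF G(1)] by auto
  ultimately have "card {e \<in> edges G. ends G e = {v, w}} \<le> card {1, -1 :: int}"
    by (intro card_inj_on_le[of "esign G"]) auto
  then show ?thesis by simp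
qed

lemma finite_neighbours: "signed_graph G \<Longrightarrow> finite {w. adjacent G v w}"
  using adjacentD(2) by (metis (no_types, lifting) finite_subset mem_Collect_eq signed_graph_def subsetI)

lemma degree_eq_sum:
  assumes G: "signed_graph G"
  shows "degree G v = (\<Sum>w\<in>{w. adjacent G v w}. card {e \<in> edges G. ends G e = {v, w}})"
proof -
  have fin: "finite (edges G)" using G by (simp add: signed_graph_def)
  have "{e \<in> edges G. v \<in> ends G e} = (\<Union>w\<in>{w. adjacent G v w}. {e \<in> edges G. ends G e = {v, w}})"
  proof (intro set_eqI iffI)
    fix e assume "e \<in> {e \<in> edges G. v \<in> ends G e}"
    then have "e \<in> edges G" "v \<in> ends G e" by auto
    then obtain w where "e \<in> edges G" "ends G e = {v, w}" using edge_other_end[OF G] by metis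
    then show "e \<in> (\<Union>w\<in>{w. adjacent G v w}. {e \<in> edges G. ends G e = {v, w}})"
      by (auto simp: adjacent_def)
  qed auto
  moreover have "card \<dots> = (\<Sum>w\<in>{w. adjacent G v w}. card {e \<in> edges G. ends G e = {v, w}})"
    by (rule card_UN_disjoint) (use fin finite_neighbours[OF G] in \<open>auto simp: doubleton_eq_iff\<close>)
  ultimately show ?thesis by (simp add: degree_def)
qed

lemma card_edges_between_pos:
  assumes "signed_graph G" "adjacent G v w"
  shows "card {e \<in> edges G. ends G e = {v, w}} \<ge> 1"
proof -
  have "finite {e \<in> edges G. ends G e = {v, w}}" using assms(1) by (simp add: signed_graph_def)
  moreover have "{e \<in> edges G. ends G e = {v, w}} \<noteq> {}" using assms(2) by (auto simp: adjacent_def)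
  ultimately show ?thesis by (simp add: Suc_le_eq card_gt_0_iff)
qed

lemma bad_lists_degree_eq:
  assumes G: "signed_graph G" "nonseparable G" and bad: "bad_lists G L"
    and v: "v \<in> verts G" "w \<in> verts G"
  shows "degree G v = degree G w"
proof -
  have le: "degree G a \<le> degree G b" if ab: "adjacent G a b" for a b
  proof -
    have V: "a \<in> verts G" "b \<in> verts G" using adjacentD[OF G(1) ab] by auto
    obtain e where e: "e \<in> edges G" "ends G e = {a, b}" using ab by (auto simp: adjacent_def)
    have "inj_on (\<lambda>c. esign G e * c) (L a)"
      using signed_graphD(3)[OF G(1) e(1)] by (auto simp: inj_on_def)
    moreover have "(\<lambda>c. esign G e * c) ` L a \<subseteq> L b" using bad_lists_edge[OF G bad e] by auto
    moreover have "finite (L b)" using bad V by (simp add: bad_lists_def)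
    ultimately have "card (L a) \<le> card (L b)" by (rule card_inj_on_le)
    then show ?thesis using bad_lists_tight[OF G(1) nonseparable_connected[OF G(2)] bad] V by simp
  qed
  show ?thesis
  proof (rule ccontr)
    assume n: "degree G v \<noteq> degree G w"
    have "reachable G v w" using nonseparable_connected[OF G(2)] v by (rule connected_reachable)
    then obtain s t where "degree G s = degree G v" "degree G t \<noteq> degree G v" "adjacent G s t"
      using reachable_cut[of G v w "{s. degree G s = degree G v}"] n by auto
    then show False using le[of s t] le[of t s] adjacent_sym[of G s t] by simp
  qed
qed

text \<open>A single neighbour \<open>u\<close> would separate \<open>v\<close> from any third
  vertex.\<close>

lemma nonseparable_two_neighbours:
  assumes G: "signed_graph G" "nonseparable G" and "card (verts G) \<ge> 3" and v: "v \<in> verts G"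
  shows "card {w. adjacent G v w} \<ge> 2"
proof -
  have finV: "finite (verts G)" using G by (simp add: signed_graph_def)
  have other: "\<exists>w. adjacent G v w \<and> w \<noteq> u" if u: "u \<in> verts G" "u \<noteq> v" for u
  proof -
    have "card {u, v} < card (verts G)" using assms(3) u by simp
    then obtain t where t: "t \<in> verts G" "t \<noteq> u" "t \<noteq> v"
      by (metis card_mono finite.intros insertCI leD subsetI finV)
    have "connected_graph (induced G (verts G - {u}))" using nonseparable_remove[OF G u(1) v u(2)] .
    then have "reachable (induced G (verts G - {u})) v t"
      by (rule connected_reachable) (use t u v in auto)
    then obtain s w where "s = v" "w \<noteq> v" "adjacent (induced G (verts G - {u})) s w"
      using reachable_cut[of _ v t "{v}"] t by blast
    then show ?thesis by (auto simp: adjacent_induced)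
  qed
  have "card {v} < card (verts G)" using assms(3) by simp
  then obtain u where "u \<in> verts G" "u \<noteq> v"
    by (metis card_mono finite.intros insertCI leD subsetI finV)
  then obtain w where w: "adjacent G v w" using other by blast
  then obtain w' where w': "adjacent G v w'" "w' \<noteq> w"
    using other[of w] adjacentD[OF G(1) w] by auto
  have "card {w, w'} \<le> card {w. adjacent G v w}"
    using finite_neighbours[OF G(1)] w w' by (intro card_mono) auto
  then show ?thesis using w' by simp
qed

section \<open>The complete case\<close>

lemma ex_nonzero: "card (S :: int set) \<ge> 2 \<Longrightarrow> \<exists>a\<in>S. a \<noteq> 0"
  using card_mono[of "{0}" S] by fastforce

text \<open>The root \<open>v0\<close> gets sign 1 and every other vertex the sign of its edge to
  \<open>v0\<close>; an edge avoiding \<open>v0\<close> is settled by its triangle with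
  \<open>v0\<close>. The triangle condition comes from bad lists in one direction of the theorem and
  from balance in the other.\<close>

lemma complete_triangle_potential:
  assumes G: "signed_graph G" and v0: "v0 \<in> verts G"
    and inj: "\<And>e e'. e \<in> edges G \<Longrightarrow> e' \<in> edges G \<Longrightarrow> ends G e = ends G e' \<Longrightarrow> e = e'"
    and adj: "\<And>v w. v \<in> verts G \<Longrightarrow> w \<in> verts G \<Longrightarrow> v \<noteq> w \<Longrightarrow> adjacent G v w"
    and tri: "\<And>e1 e2 e v u w. \<lbrakk>e1 \<in> edges G; ends G e1 = {v, u}; e2 \<in> edges G; ends G e2 = {v, w};
      e \<in> edges G; ends G e = {u, w}\<rbrakk> \<Longrightarrow> esign G e = esign G e1 * esign G e2"
  obtains s where "\<And>v. v \<in> verts G \<Longrightarrow> s v = 1 \<or> s v = (-1::int)"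
    "\<And>e v w. e \<in> edges G \<Longrightarrow> ends G e = {v, w} \<Longrightarrow> esign G e = s v * s w"
proof -
  define s where "s v = (if v = v0 then 1 else esign G (SOME e. e \<in> edges G \<and> ends G e = {v0, v}))" for v
  have s: "s v = esign G e" if "e \<in> edges G" "ends G e = {v0, v}" for e v
  proof -
    have "v \<noteq> v0" using edge_ends_neq[OF G that] by simp
    moreover have "(SOME e. e \<in> edges G \<and> ends G e = {v0, v}) = e"
      using that inj by (intro some_equality) auto
    ultimately show ?thesis by (simp add: s_def)
  qed
  show thesis
  proof (rule that[of s])
    fix v assume v: "v \<in> verts G"
    show "s v = 1 \<or> s v = -1"
    proof (cases "v = v0")
      case False
      then obtain e where "e \<in> edges G" "ends G e = {v0, v}"
        using adj[OF v0 v] by (auto simp: adjacent_def)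
      then show ?thesis using s signed_graphD(3)[OF G] by metis
    qed (simp add: s_def)
  next
    fix e v w assume e: "e \<in> edges G" "ends G e = {v, w}"
    have inV: "v \<in> verts G" "w \<in> verts G" using signed_graphD(1)[OF G e(1)] e(2) by auto
    consider "v = v0" | "w = v0" | "v \<noteq> v0" "w \<noteq> v0" by blast
    then show "esign G e = s v * s w"
    proof cases
      case 1
      then show ?thesis using s[of e w] e by (simp add: s_def)
    next
      case 2
      then show ?thesis using s[of e v] e by (simp add: s_def insert_commute)
    next
      case 3
      then have "adjacent G v0 v" "adjacent G v0 w" using adj v0 inV by auto
      then obtain e1 e2 where e12: "e1 \<in> edges G" "ends G e1 = {v0, v}" "e2 \<in> edges G" "ends G e2 = {v0, w}"
        by (auto simp: adjacent_def)
      show ?thesis using tri[OF e12 e] s[OF e12(1,2)] s[OF e12(3,4)] by simp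
    qed
  qed
qed

text \<open>Any two edges at a vertex that lead to different neighbours close up to a positive
  triangle, as deleting two vertices never disconnects the rest. So two neighbours of a vertex are
  adjacent, and the connected graph is complete. Without parallel edges the triangles give a
  potential; a single doubled edge spreads to all pairs.\<close>

lemma bad_lists_complete_brick:
  assumes G: "signed_graph G" "nonseparable G" and bad: "bad_lists G L"
    and two: "card (verts G) \<ge> 2"
    and nosep: "\<And>u w. u \<in> verts G \<Longrightarrow> w \<in> verts G \<Longrightarrow> u \<noteq> w \<Longrightarrow> verts G - {u, w} \<noteq> {} \<Longrightarrow>
      connected_graph (induced G (verts G - {u, w}))"
  shows "brick G"
proof -
  let ?V = "verts G"
  have finV: "finite ?V" using G by (simp add: signed_graph_def)
  have conn: "connected_graph G" by (rule nonseparable_connected[OF G(2)])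
  have tri: "\<exists>e3\<in>edges G. ends G e3 = {u, w} \<and> esign G e3 = esign G e1 * esign G e2"
    if e: "e1 \<in> edges G" "ends G e1 = {v, u}" "e2 \<in> edges G" "ends G e2 = {v, w}" "u \<noteq> w" for v u w e1 e2
  proof -
    have V: "v \<in> ?V" "u \<in> ?V" "w \<in> ?V" "v \<noteq> u" "v \<noteq> w"
      using signed_graphD(1)[OF G(1) e(1)] signed_graphD(1)[OF G(1) e(3)]
        edge_ends_neq[OF G(1)] e by auto
    have c: "connected_graph (induced G (?V - {u, w}))" using nosep V e(5) by blast
    have "e1 \<noteq> e2" using e by (auto simp: doubleton_eq_iff)
    moreover have "card {e1, e2} \<le> degree G v"
      unfolding degree_def using G(1) e by (intro card_mono) (auto simp: signed_graph_def)
    \<comment> \<open>Two colors guarantee a nonzero one; only from a nonzero color can the signs be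
      recovered.\<close>
    ultimately have "card (L v) \<ge> 2" using bad V by (fastforce simp: bad_lists_def)
    then obtain a where a: "a \<in> L v" "a \<noteq> 0" using ex_nonzero by blast
    obtain e3 where "e3 \<in> edges G" "ends G e3 = {u, w}" "esign G e1 * a = esign G e3 * (esign G e2 * a)"
      using bad_lists_triangle[OF G bad e c a(1)] by blast
    moreover then have "esign G e1 = esign G e3 * esign G e2" using a(2) by auto
    ultimately show ?thesis
      using signed_graphD(3)[OF G(1) e(3)] by (intro bexI[of _ e3]) auto
  qed
  have adj: "adjacent G v w" if vw: "v \<in> ?V" "w \<in> ?V" "v \<noteq> w" for v w
  proof (rule ccontr)
    assume n: "\<not> adjacent G v w"
    let ?S = "insert v {s. adjacent G v s}"
    have "reachable G v w" using conn vw(1,2) by (rule connected_reachable)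
    moreover have "v \<in> ?S" "w \<notin> ?S" using n vw by auto
    ultimately obtain s t where st: "s \<in> ?S" "t \<notin> ?S" "adjacent G s t"
      using reachable_cut[of G v w ?S] by blast
    then have "adjacent G s v" using adjacent_sym[of G v s] by auto
    then obtain e1 where e1: "e1 \<in> edges G" "ends G e1 = {s, v}" by (auto simp: adjacent_def)
    obtain e2 where e2: "e2 \<in> edges G" "ends G e2 = {s, t}" using st(3) by (auto simp: adjacent_def)
    have "adjacent G v t" using tri[OF e1 e2] st by (auto simp: adjacent_def)
    then show False using st by simp
  qed
  have ends: "ends G e \<in> complete_edges ?V" if "e \<in> edges G" for e
  proof -
    have "card (ends G e) = 2" "ends G e \<subseteq> ?V" using signed_graphD[OF G(1) that] by auto
    then show ?thesis by (auto simp: complete_edges_def card_2_iff)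
  qed
  show ?thesis
  proof (cases "inj_on (ends G) (edges G)")
    case True
    have simple: "underlying_simple G ?V (complete_edges ?V)"
    proof (rule underlying_simpleI)
      show "\<exists>e\<in>edges G. ends G e = f" if "f \<in> complete_edges ?V" for f
        using that adj by (auto simp: complete_edges_def adjacent_def)
    qed (use ends True in \<open>auto dest: inj_onD\<close>)
    obtain v0 where v0: "v0 \<in> ?V" using conn by (auto simp: connected_graph_def)
    have tri': "esign G e = esign G e1 * esign G e2"
      if e: "e1 \<in> edges G" "ends G e1 = {v, u}" "e2 \<in> edges G" "ends G e2 = {v, w}"
        "e \<in> edges G" "ends G e = {u, w}" for e1 e2 e v u w
    proof -
      have "u \<noteq> w" using edge_ends_neq[OF G(1) e(5,6)] .
      then obtain e3 where e3: "e3 \<in> edges G" "ends G e3 = {u, w}" "esign G e3 = esign G e1 * esign G e2"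
        using tri[OF e(1-4)] by blast
      then show ?thesis using inj_onD[OF True, of e3 e] e by simp
    qed
    obtain s where s: "\<And>v. v \<in> ?V \<Longrightarrow> s v = 1 \<or> s v = (-1::int)"
      "\<And>e v w. e \<in> edges G \<Longrightarrow> ends G e = {v, w} \<Longrightarrow> esign G e = s v * s w"
      by (rule complete_triangle_potential[OF G(1) v0 inj_onD[OF True] adj tri']) blast+
    have "balanced G"
    proof (rule potential_balanced[of G s])
      fix e assume e: "e \<in> edges G"
      obtain v w where "ends G e = {v, w}" using signed_graphD(2)[OF G(1) e] by (auto simp: card_2_iff)
      then show "\<exists>v w. ends G e = {v, w} \<and> esign G e = s v * s w" using s(2)[OF e] by blast
    qed (use s in auto)
    moreover have "complete_graph (card ?V) G"
      unfolding complete_graph_def using simple finV by blast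
    moreover have "card ?V \<ge> 1" using two by simp
    ultimately show ?thesis using G(1) unfolding brick_def by blast
  next
    case False
    define dbl where "dbl v w \<longleftrightarrow> (\<forall>s\<in>{1, -1}. \<exists>e\<in>edges G. ends G e = {v, w} \<and> esign G e = s)" for v w
    have dbl_sym: "dbl v w \<Longrightarrow> dbl w v" for v w unfolding dbl_def by (simp add: insert_commute)
    obtain e e' where e: "e \<in> edges G" "e' \<in> edges G" "ends G e = ends G e'" "e \<noteq> e'"
      using False by (auto simp: inj_on_def)
    obtain p q where pq: "ends G e = {p, q}" using signed_graphD(2)[OF G(1) e(1)] by (auto simp: card_2_iff)
    have "esign G e' = - esign G e"
      using bad_lists_double_edge(1)[OF G bad e(1) pq e(2)] e pq by simp
    then have dpq: "dbl p q" unfolding dbl_def using e pq signed_graphD(3)[OF G(1) e(1)] by auto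
    \<comment> \<open>An edge \<open>v w\<close> of sign \<open>t\<close> and the edge
      \<open>v u\<close> of sign \<open>s * t\<close> close up to an edge \<open>u w\<close> of sign
      \<open>s\<close>, for either \<open>s\<close>.\<close>
    have step: "dbl u w" if vu: "dbl v u" and w: "w \<in> ?V" "w \<noteq> u" for v u w
    proof (cases "w = v")
      case True
      then show ?thesis using vu dbl_sym by simp
    next
      case False
      obtain f where "f \<in> edges G" "ends G f = {v, u}" using vu by (auto simp: dbl_def)
      then have "v \<in> ?V" using signed_graphD(1)[OF G(1)] by auto
      then obtain e2 where e2: "e2 \<in> edges G" "ends G e2 = {v, w}"
        using adj[of v w] w(1) False by (auto simp: adjacent_def)
      show ?thesis unfolding dbl_def
      proof
        fix s :: int assume s: "s \<in> {1, -1}"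
        then have "s * esign G e2 \<in> {1, -1}" using signed_graphD(3)[OF G(1) e2(1)] by auto
        then obtain e1 where e1: "e1 \<in> edges G" "ends G e1 = {v, u}" "esign G e1 = s * esign G e2"
          using vu unfolding dbl_def by blast
        have "esign G e1 * esign G e2 = s" using e1(3) signed_graphD(3)[OF G(1) e2(1)] by auto
        then show "\<exists>e\<in>edges G. ends G e = {u, w} \<and> esign G e = s"
          using tri[OF e1(1,2) e2] w(2) by auto
      qed
    qed
    have dblV: "dbl v w" if "v \<in> ?V" "w \<in> ?V" "v \<noteq> w" for v w
    proof (cases "v = q")
      case True
      then show ?thesis using step[OF dpq] that by auto
    next
      case False
      then show ?thesis using step[OF step[OF dpq that(1) False] that(2)] that(3) by auto
    qed
    have "doubled G ?V (complete_edges ?V)"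
    proof (rule doubledI)
      show "\<exists>e\<in>edges G. ends G e = f \<and> esign G e = s" if "f \<in> complete_edges ?V" "s \<in> {1, -1}" for f s
        using that dblV unfolding complete_edges_def dbl_def by blast
    qed (use ends bad_lists_edge_unique[OF G bad] in auto)
    then have "doubled_complete (card ?V) G" unfolding doubled_complete_def using finV by blast
    then show ?thesis using G(1) two unfolding brick_def by blast
  qed
qed

section \<open>The cycle case\<close>

text \<open>Two colors \<open>a\<close> and \<open>b\<close> of the first list, carried along the
  cycle by the partial sign products and used alternately, can conflict only at the closing edge.
  There the last vertex carries \<open>a\<close> for odd \<open>n\<close> and \<open>b\<close> for
  even \<open>n\<close>, and a clash is avoided unless parity and sign product match as in a
  brick.\<close>

lemma bad_lists_simple_cycle_brick:
  assumes G: "signed_graph G" "nonseparable G" and bad: "bad_lists G L"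
    and n: "n \<ge> 2" "length vs = n" "length es = n" "distinct vs" "distinct es"
    "verts G = set vs" "edges G = set es"
    "\<And>i. i < n \<Longrightarrow> ends G (es ! i) = {vs ! i, vs ! (Suc i mod n)}"
    and two: "card (L (vs ! 0)) \<ge> 2"
  shows "brick G"
proof -
  define P where "P = (\<Prod>i<n. esign G (es ! i))"
  define S where "S i = (\<Prod>j<i. esign G (es ! j))" for i
  have sgn: "esign G (es ! i) = 1 \<or> esign G (es ! i) = -1" if "i < n" for i
    using signed_graphD(3)[OF G(1)] n that by auto
  have S1: "S i = 1 \<or> S i = -1" if "i \<le> n" for i
    unfolding S_def using sgn that by (intro prod_sign) auto
  have P1: "P = 1 \<or> P = -1" using S1[of n] by (simp add: S_def P_def)
  have odd: "odd n \<longleftrightarrow> P = 1"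
  proof (rule ccontr)
    assume wrong: "\<not> ?thesis"
    \<comment> \<open>For odd \<open>n\<close> and \<open>P = -1\<close> the closing edge compares
      \<open>a\<close> with \<open>-a\<close>, hence \<open>a \<noteq> 0\<close>; for even
      \<open>n\<close> and \<open>P = 1\<close> it compares \<open>b\<close> with
      \<open>a\<close>.\<close>
    obtain a where a: "a \<in> L (vs ! 0)" "a \<noteq> 0" using ex_nonzero[OF two] by blast
    obtain b where b: "b \<in> L (vs ! 0)" "b \<noteq> a"
    proof -
      have "\<not> L (vs ! 0) \<subseteq> {a}" using card_mono[of "{a}" "L (vs ! 0)"] two by auto
      then show thesis using that by blast
    qed
    have mem: "S i * c \<in> L (vs ! i)" if "i < n" "c \<in> L (vs ! 0)" for i c
      using that(1)
    proof (induction i)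
      case 0
      then show ?case using that by (simp add: S_def)
    next
      case (Suc i)
      then have "es ! i \<in> edges G" "ends G (es ! i) = {vs ! i, vs ! Suc i}" "S i * c \<in> L (vs ! i)"
        using n by auto
      from bad_lists_edge[OF G bad this] show ?case by (simp add: S_def mult_ac)
    qed
    obtain \<phi> where \<phi>: "\<And>i. i < n \<Longrightarrow> \<phi> (vs ! i) = S i * (if even i then a else b)"
      using ex_fun_nth[OF n(4), of "\<lambda>i. S i * (if even i then a else b)"] n(2) by blast
    have "coloring G \<phi>"
    proof (rule coloringI[OF G(1)])
      fix e assume "e \<in> edges G"
      then obtain i where i: "i < n" "e = es ! i" using n(3,7) by (auto simp: in_set_conv_nth)
      have "\<phi> (vs ! i) \<noteq> esign G e * \<phi> (vs ! (Suc i mod n))"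
      proof (cases "Suc i = n")
        case False
        then have "\<phi> (vs ! (Suc i mod n)) = S i * esign G e * (if even i then b else a)"
          using \<phi>[of "Suc i"] i by (simp add: S_def)
        then show ?thesis using \<phi>[OF i(1)] S1[of i] sgn[OF i(1)] i b(2) by auto
      next
        case True
        then have "\<phi> (vs ! (Suc i mod n)) = a" using \<phi>[of 0] by (simp add: S_def)
        moreover have "S i * esign G e = P" using True i by (auto simp: S_def P_def)
        then have "esign G e = P * S i" using S1[of i] i by auto
        moreover have "even i \<longleftrightarrow> odd n" using True by auto
        ultimately show ?thesis using wrong P1 \<phi>[OF i(1)] S1[of i] i a(2) b(2) by auto
      qed
      then show "\<exists>v w. ends G e = {v, w} \<and> \<phi> v \<noteq> esign G e * \<phi> w" using n(8) i by blast
    qed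
    moreover have "\<phi> v \<in> L v" if v: "v \<in> verts G" for v
    proof -
      obtain i where "i < n" "v = vs ! i" using v n(2,6) by (auto simp: in_set_conv_nth)
      then show ?thesis using \<phi> mem a b by auto
    qed
    ultimately show False using bad by (auto simp: bad_lists_def list_coloring_def)
  qed
  have "cycle_graph n G" using n unfolding cycle_graph_def by blast
  moreover have "balanced G \<longleftrightarrow> odd n"
    using cycle_balanced_iff[OF G(1) n] odd by (simp add: P_def)
  ultimately show ?thesis using G(1) unfolding brick_def by blast
qed

text \<open>On a cycle of even length one could alternate two colors of different absolute value,
  which no sign can make clash. Three colors suffice to find them, since \<open>{a, -a}\<close> has
  at most two elements.\<close>

lemma bad_lists_double_cycle_odd:
  assumes G: "signed_graph G" "nonseparable G" and bad: "bad_lists G L"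
    and vs: "distinct vs" "set vs = verts G" "length vs \<ge> 3"
    and ends: "\<And>e. e \<in> edges G \<Longrightarrow> ends G e \<in> cycle_edges vs"
    and L: "\<And>v w. v \<in> verts G \<Longrightarrow> w \<in> verts G \<Longrightarrow> L v = L w" "\<And>v. v \<in> verts G \<Longrightarrow> card (L v) \<ge> 3"
  shows "odd (length vs)"
proof
  define n where "n = length vs"
  assume "even (length vs)"
  then have even: "even n" by (simp add: n_def)
  have v0: "vs ! 0 \<in> verts G" using vs by (metis length_greater_0_conv list.size(3) not_numeral_le_zero nth_mem)
  have "card (L (vs ! 0)) \<ge> 3" using L(2) v0 by simp
  then obtain a where a: "a \<in> L (vs ! 0)" by fastforce
  obtain b where b: "b \<in> L (vs ! 0)" "b \<noteq> a" "b \<noteq> - a"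
  proof -
    have "card {a, -a} \<le> 2" by (simp add: card_insert_if)
    then have "\<not> L (vs ! 0) \<subseteq> {a, -a}" using card_mono[of "{a, -a}" "L (vs ! 0)"] \<open>card (L (vs ! 0)) \<ge> 3\<close> by auto
    then show thesis using that by blast
  qed
  obtain \<phi> where \<phi>: "\<And>i. i < n \<Longrightarrow> \<phi> (vs ! i) = (if even i then a else b)"
    using ex_fun_nth[OF vs(1), of "\<lambda>i. if even i then a else b"] by (auto simp: n_def)
  have "coloring G \<phi>"
  proof (rule coloringI[OF G(1)])
    fix e assume e: "e \<in> edges G"
    then obtain i where i: "i < n" "ends G e = {vs ! i, vs ! (Suc i mod n)}"
      using ends[OF e] by (auto simp: cycle_edges_def n_def)
    have "even (Suc i mod n) \<longleftrightarrow> odd i" using i(1) even by (auto simp: Suc_mod_cases)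
    moreover have "Suc i mod n < n" using i(1) by simp
    ultimately have "\<phi> (vs ! i) \<noteq> esign G e * \<phi> (vs ! (Suc i mod n))"
      using \<phi>[OF i(1)] \<phi>[of "Suc i mod n"] b signed_graphD(3)[OF G(1) e] by auto
    then show "\<exists>v w. ends G e = {v, w} \<and> \<phi> v \<noteq> esign G e * \<phi> w" using i by blast
  qed
  moreover have "\<phi> v \<in> L v" if v: "v \<in> verts G" for v
  proof -
    have "v \<in> set vs" using v vs(2) by simp
    then obtain i where "i < n" "v = vs ! i" by (auto simp: in_set_conv_nth n_def)
    then show ?thesis using \<phi> a b L(1)[OF v v0] by auto
  qed
  ultimately show False using bad by (auto simp: bad_lists_def list_coloring_def)
qed

text \<open>The degree is the sum of two multiplicities, each 1 or 2. So \<open>r = 2\<close> makes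
  all edges simple and \<open>r = 4\<close> makes all of them doubled.\<close>

lemma bad_lists_two_regular_brick:
  assumes G: "signed_graph G" "nonseparable G" and bad: "bad_lists G L"
    and two: "\<And>v. v \<in> verts G \<Longrightarrow> card {w. adjacent G v w} = 2"
    and reg: "\<And>v. v \<in> verts G \<Longrightarrow> degree G v = r" and r: "r = 2 \<or> r = 4"
  shows "brick G"
proof -
  let ?m = "\<lambda>v w. card {e \<in> edges G. ends G e = {v, w}}"
  have conn: "connected_graph G" by (rule nonseparable_connected[OF G(2)])
  have fin: "finite (edges G)" using G by (simp add: signed_graph_def)
  have cardL: "card (L v) = r" if "v \<in> verts G" for v
    using bad_lists_tight[OF G(1) conn bad that] reg[OF that] by simp
  obtain vs where vs: "distinct vs" "set vs = verts G" "length vs \<ge> 3"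
    "\<And>x y. adjacent G x y \<longleftrightarrow> {x, y} \<in> cycle_edges vs"
    using two_regular_cycle[OF G(1) conn two] by metis
  have ends: "ends G e \<in> cycle_edges vs" if e: "e \<in> edges G" for e
  proof -
    obtain x y where "ends G e = {x, y}" using signed_graphD(2)[OF G(1) e] by (auto simp: card_2_iff)
    then show ?thesis using vs(4)[of x y] e by (auto simp: adjacent_def)
  qed
  have m: "?m v w = (if r = 2 then 1 else 2)" if vw: "adjacent G v w" for v w
  proof -
    obtain p q where pq: "{w. adjacent G v w} = {p, q}" "p \<noteq> q"
      using two[OF adjacentD(1)[OF G(1) vw]] by (auto simp: card_2_iff)
    have "r = ?m v p + ?m v q"
      using degree_eq_sum[OF G(1), of v] reg[OF adjacentD(1)[OF G(1) vw]] pq by simp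
    moreover have "?m v p \<ge> 1" "?m v q \<ge> 1" using card_edges_between_pos[OF G(1)] pq by auto
    moreover have "?m v p \<le> 2" "?m v q \<le> 2" using card_edges_between_le[OF G bad] by auto
    moreover have "w = p \<or> w = q" using pq vw by auto
    ultimately show ?thesis using r by auto
  qed
  show ?thesis
  proof (cases "r = 2")
    case True
    define n where "n = length vs"
    have simple: "e = e'" if "e \<in> edges G" "e' \<in> edges G" "ends G e = {v, w}" "ends G e' = {v, w}" for e e' v w
    proof -
      have "adjacent G v w" using that by (auto simp: adjacent_def)
      then have "?m v w = 1" using m True by simp
      then obtain z where "{e \<in> edges G. ends G e = {v, w}} = {z}" by (auto simp: card_1_singleton_iff)
      moreover have "e \<in> {e \<in> edges G. ends G e = {v, w}}" "e' \<in> {e \<in> edges G. ends G e = {v, w}}"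
        using that by auto
      ultimately show ?thesis by (metis singletonD)
    qed
    have "\<exists>e\<in>edges G. ends G e = {vs ! i, vs ! (Suc i mod n)}" if "i < n" for i
      using vs(4)[of "vs ! i" "vs ! (Suc i mod n)"] that
      by (auto simp: adjacent_def cycle_edges_def n_def)
    then obtain f where f: "\<And>i. i < n \<Longrightarrow> f i \<in> edges G"
      "\<And>i. i < n \<Longrightarrow> ends G (f i) = {vs ! i, vs ! (Suc i mod n)}" by metis
    define es where "es = map f [0..<n]"
    have es: "length es = n" "\<And>i. i < n \<Longrightarrow> es ! i = f i" by (simp_all add: es_def)
    have "inj_on f {0..<n}"
    proof (rule inj_onI)
      fix i j assume "i \<in> {0..<n}" "j \<in> {0..<n}" "f i = f j"
      then show "i = j" using f(2)[of i] f(2)[of j] cycle_edges_inj[of vs n i j] vs by (simp add: n_def)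
    qed
    then have dist: "distinct es" by (simp add: es_def distinct_map)
    have edges: "edges G = set es"
    proof
      show "set es \<subseteq> edges G" using f by (auto simp: es_def)
      show "edges G \<subseteq> set es"
      proof
        fix e assume e: "e \<in> edges G"
        then obtain i where i: "i < n" "ends G e = {vs ! i, vs ! (Suc i mod n)}"
          using ends[OF e] by (auto simp: cycle_edges_def n_def)
        then have "e = f i" using simple[OF e f(1) _ f(2)] by simp
        then show "e \<in> set es" using i by (simp add: es_def)
      qed
    qed
    have "vs ! 0 \<in> verts G" using vs(2,3) by (metis nth_mem not_numeral_le_zero gr0I)
    then have two: "card (L (vs ! 0)) \<ge> 2" using cardL True by simp
    have "n \<ge> 2" "length vs = n" using vs(3) by (auto simp: n_def)
    moreover have "ends G (es ! i) = {vs ! i, vs ! (Suc i mod n)}" if "i < n" for i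
      using es(2) f(2) that by simp
    ultimately show ?thesis
      using bad_lists_simple_cycle_brick[OF G bad _ _ es(1) vs(1) dist vs(2)[symmetric] edges _ two] by blast
  next
    case False
    have dbl: "\<exists>e e'. e \<in> edges G \<and> e' \<in> edges G \<and> ends G e = {v, w} \<and> ends G e' = {v, w} \<and> e \<noteq> e'"
      if "adjacent G v w" for v w
    proof -
      have "?m v w = 2" using m[OF that] False by simp
      then obtain e e' where "{e \<in> edges G. ends G e = {v, w}} = {e, e'}" "e \<noteq> e'"
        by (auto simp: card_2_iff)
      then show ?thesis by blast
    qed
    \<comment> \<open>The two edges have opposite signs, so one of the two carried colors is
      \<open>c\<close> itself.\<close>
    have sub: "L v \<subseteq> L w" if vw: "adjacent G v w" for v w
    proof
      fix c assume c: "c \<in> L v"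
      obtain e e' where e: "e \<in> edges G" "ends G e = {v, w}" "e' \<in> edges G" "ends G e' = {v, w}" "e \<noteq> e'"
        using dbl[OF vw] by blast
      have "esign G e * c \<in> L w" "esign G e' * c \<in> L w"
        using bad_lists_edge[OF G bad e(1,2) c] bad_lists_edge[OF G bad e(3,4) c] by auto
      then show "c \<in> L w"
        using bad_lists_double_edge(1)[OF G bad e] signed_graphD(3)[OF G(1) e(1)] by auto
    qed
    have Leq: "L v = L w" if vw: "v \<in> verts G" "w \<in> verts G" for v w
    proof (rule ccontr)
      assume n: "L v \<noteq> L w"
      have "reachable G v w" using conn vw by (rule connected_reachable)
      then obtain s t where "L s = L v" "L t \<noteq> L v" "adjacent G s t"
        using reachable_cut[of G v w "{s. L s = L v}"] n by auto
      then show False using sub[of s t] sub[of t s] adjacent_sym[of G s t] by blast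
    qed
    have "card (L v) \<ge> 3" if "v \<in> verts G" for v using cardL[OF that] r False by simp
    from bad_lists_double_cycle_odd[OF G bad vs(1-3) ends Leq this] have odd: "odd (length vs)" .
    have "doubled G (set vs) (cycle_edges vs)"
    proof (rule doubledI)
      fix f and s :: int assume f: "f \<in> cycle_edges vs" "s \<in> {1, -1}"
      then obtain v w where vw: "f = {v, w}" by (auto simp: cycle_edges_def)
      then obtain e e' where e: "e \<in> edges G" "ends G e = {v, w}" "e' \<in> edges G" "ends G e' = {v, w}" "e \<noteq> e'"
        using dbl[of v w] vs(4) f by blast
      then show "\<exists>e\<in>edges G. ends G e = f \<and> esign G e = s"
        using bad_lists_double_edge(1)[OF G bad e] signed_graphD(3)[OF G(1) e(1)] f(2) vw by auto
    qed (use ends vs bad_lists_edge_unique[OF G bad] in auto)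
    then have "doubled_cycle (length vs) G" using vs(1) unfolding doubled_cycle_def by blast
    then show ?thesis using odd vs(3) G(1) unfolding brick_def by blast
  qed
qed

section \<open>The case distinction between complete graphs and cycles\<close>

lemma bad_lists_nonseparable_brick:
  assumes G: "signed_graph G" "nonseparable G" and bad: "bad_lists G L"
  shows "brick G"
proof -
  let ?V = "verts G"
  let ?N = "\<lambda>v. {w. adjacent G v w}"
  let ?m = "\<lambda>v w. card {e \<in> edges G. ends G e = {v, w}}"
  have conn: "connected_graph G" by (rule nonseparable_connected[OF G(2)])
  have finV: "finite ?V" using G by (simp add: signed_graph_def)
  have tight: "card (L v) = degree G v" if "v \<in> ?V" for v by (rule bad_lists_tight[OF G(1) conn bad that])
  \<comment> \<open>The triangle argument would force an edge \<open>u w\<close>; this rules out the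
    second alternative of \<open>separating_pair_neighbours\<close>.\<close>
  have nontriv: "\<not> (adjacent G v u \<and> adjacent G v w \<and> u \<noteq> w \<and> \<not> adjacent G u w \<and>
      connected_graph (induced G (?V - {u, w})))" for v u w
  proof
    assume *: "adjacent G v u \<and> adjacent G v w \<and> u \<noteq> w \<and> \<not> adjacent G u w \<and>
      connected_graph (induced G (?V - {u, w}))"
    then obtain e1 e2 where e: "e1 \<in> edges G" "ends G e1 = {v, u}" "e2 \<in> edges G" "ends G e2 = {v, w}"
      by (auto simp: adjacent_def)
    obtain a where "a \<in> L v" using bad_lists_nonempty[OF G(1) bad e(1)] e(2) by blast
    then show False using bad_lists_triangle[OF G bad e] * by (auto simp: adjacent_def)
  qed
  consider "card ?V = 1" | "card ?V \<ge> 2" "\<And>u w. u \<in> ?V \<Longrightarrow> w \<in> ?V \<Longrightarrow> u \<noteq> w \<Longrightarrow> ?V - {u, w} \<noteq> {} \<Longrightarrow>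
      connected_graph (induced G (?V - {u, w}))"
    | x y where "x \<in> ?V" "y \<in> ?V" "x \<noteq> y" "?V - {x, y} \<noteq> {}"
      "\<not> connected_graph (induced G (?V - {x, y}))"
  proof -
    have "card ?V \<noteq> 0" using conn finV by (auto simp: connected_graph_def)
    then have "card ?V = 1 \<or> card ?V \<ge> 2" by auto
    then show thesis using that by blast
  qed
  then show ?thesis
  proof cases
    case 1
    then obtain v where v: "?V = {v}" by (auto simp: card_1_singleton_iff)
    have no: "edges G = {}"
    proof -
      have "e \<notin> edges G" for e using signed_graphD(1,2)[OF G(1), of e] v card_mono[of "{v}" "ends G e"] by auto
      then show ?thesis by blast
    qed
    have "underlying_simple G ?V (complete_edges ?V)"
      using no v by (auto simp: underlying_simple_def complete_edges_def bij_betw_def)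
    then have "complete_graph 1 G" unfolding complete_graph_def using 1 finV by blast
    moreover have "balanced G" using no by (intro potential_balanced[of G "\<lambda>_. 1"]) auto
    ultimately show ?thesis using G(1) unfolding brick_def by blast
  next
    case 2
    then show ?thesis by (rule bad_lists_complete_brick[OF G bad])
  next
    case (3 x y)
    have split2: "card (?N p) = 2"
      if pq: "p \<in> ?V" "q \<in> ?V" "p \<noteq> q" "?V - {p, q} \<noteq> {}" "\<not> connected_graph (induced G (?V - {p, q}))" for p q
    proof -
      obtain a b where ab: "a \<in> ?V - {p, q}" "b \<in> ?V - {p, q}" "\<not> reachable (induced G (?V - {p, q})) a b"
        using pq(4,5) by (auto simp: connected_graph_def)
      show ?thesis
        by (rule separating_pair_neighbours[OF G pq(1-3) ab]) (use nontriv in auto)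
    qed
    have "\<exists>z. z \<in> ?V - {x, y}" using 3 by blast
    then obtain z where z: "z \<in> ?V" "z \<noteq> x" "z \<noteq> y" by auto
    have "card {x, y, z} \<le> card ?V" using 3 z finV by (intro card_mono) auto
    then have three: "card ?V \<ge> 3" using 3 z by simp
    have ge2: "card (?N v) \<ge> 2" if "v \<in> ?V" for v
      by (rule nonseparable_two_neighbours[OF G three that])
    define r where "r = degree G x"
    have reg: "degree G v = r" if "v \<in> ?V" for v
      using bad_lists_degree_eq[OF G bad that 3(1)] by (simp add: r_def)
    have mpos: "?m v w \<ge> 1" if "adjacent G v w" for v w by (rule card_edges_between_pos[OF G(1) that])
    have m2: "?m v w \<le> 2" for v w by (rule card_edges_between_le[OF G bad])
    have finN: "finite (?N v)" for v by (rule finite_neighbours[OF G(1)])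
    have deg: "degree G v = (\<Sum>w\<in>?N v. ?m v w)" for v by (rule degree_eq_sum[OF G(1)])
    have x2: "card (?N x) = 2" using split2 3 by blast
    have dbl: "\<exists>e e'. e \<in> edges G \<and> e' \<in> edges G \<and> ends G e = {v, w} \<and> ends G e' = {v, w} \<and> e \<noteq> e'"
      if vw: "?m v w = 2" for v w
    proof -
      obtain e e' where "{e \<in> edges G. ends G e = {v, w}} = {e, e'}" "e \<noteq> e'"
        using vw by (auto simp: card_2_iff)
      then show ?thesis by blast
    qed
    obtain u w where uw: "?N x = {u, w}" "u \<noteq> w" using x2 by (auto simp: card_2_iff)
    have rsum: "r = ?m x u + ?m x w" using deg[of x] uw by (simp add: r_def)
    have u1: "?m x u \<ge> 1" "?m x w \<ge> 1" using mpos uw by auto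
    \<comment> \<open>Degree 3 at \<open>x\<close> splits as 1 + 2, so one of its two neighbours is
      joined to it by a doubled edge and the list at \<open>x\<close> has even size.\<close>
    have "r \<noteq> 3"
    proof
      assume r3: "r = 3"
      then have "?m x u = 2 \<or> ?m x w = 2" using rsum u1 m2[of x u] m2[of x w] by linarith
      then obtain t e e' where e: "e \<in> edges G" "ends G e = {x, t}" "e' \<in> edges G" "ends G e' = {x, t}" "e \<noteq> e'"
        using dbl by blast
      have "finite (L x)" using bad 3(1) by (simp add: bad_lists_def)
      then have "even (card (L x))"
        using bad_lists_double_edge(2,3)[OF G bad e] by (rule even_card_symmetric)
      then show False using tight[OF 3(1)] r3 by (simp add: r_def)
    qed
    then have r: "r = 2 \<or> r = 4" using rsum u1 m2[of x u] m2[of x w] by linarith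
    have "card (?N v) = 2" if v: "v \<in> ?V" for v
    proof (cases "r = 2")
      case True
      have "card (?N v) = (\<Sum>w\<in>?N v. 1)" by simp
      also have "\<dots> \<le> (\<Sum>w\<in>?N v. ?m v w)" by (rule sum_mono) (use mpos in simp)
      also have "\<dots> = 2" using deg[of v] reg[OF v] True by simp
      finally show ?thesis using ge2[OF v] by simp
    next
      case False
      then have r4: "r = 4" using r by simp
      have full: "?m s t = 2" if s: "card (?N s) = 2" "adjacent G s t" for s t
      proof -
        obtain p q where pq: "?N s = {p, q}" "p \<noteq> q" using s(1) by (auto simp: card_2_iff)
        have "?m s p + ?m s q = 4" using deg[of s] reg[OF adjacentD(1)[OF G(1) s(2)]] r4 pq by simp
        then have "?m s p = 2" "?m s q = 2" using m2[of s p] m2[of s q] by linarith+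
        then show ?thesis using pq s(2) by auto
      qed
      \<comment> \<open>Two of the four edges at \<open>t\<close> go to \<open>s\<close>. If
        \<open>t\<close> had at least two further neighbours, each of them would be adjacent to
        \<open>s\<close>, giving \<open>s\<close> at least three neighbours together with
        \<open>t\<close>.\<close>
      have step: "card (?N t) = 2" if s: "card (?N s) = 2" "adjacent G s t" for s t
      proof (rule ccontr)
        assume n2: "card (?N t) \<noteq> 2"
        have tV: "t \<in> ?V" "s \<in> ?V" "s \<noteq> t" using adjacentD[OF G(1) s(2)] by auto
        have st: "adjacent G t s" using s(2) adjacent_sym[of G s t] by simp
        have "?m t s = 2" using full[OF s] by (simp add: insert_commute)
        have rest: "(\<Sum>w\<in>?N t - {s}. ?m t w) = 2"
          using deg[of t] reg[OF tV(1)] r4 \<open>?m t s = 2\<close> st finN[of t]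
          by (simp add: sum.remove[of "?N t" s])
        have "card (?N t - {s}) \<ge> 2" using n2 ge2[OF tV(1)] st finN[of t] by simp
        \<comment> \<open>Otherwise \<open>t\<close> is a common neighbour of the nonadjacent
          \<open>s\<close> and \<open>p\<close>, so \<open>{p, s}\<close> separates and
          \<open>p\<close> has only two neighbours. Then \<open>t p\<close> is doubled and uses up
          the remaining edges at \<open>t\<close>.\<close>
        have nb: "adjacent G s p" if p: "p \<in> ?N t - {s}" for p
        proof (rule ccontr)
          assume n: "\<not> adjacent G s p"
          have pV: "p \<in> ?V" "p \<noteq> s" "adjacent G t p" "p \<noteq> t" using p adjacentD[OF G(1), of t p] by auto
          have "t \<in> ?V - {s, p}" using tV pV by simp
          moreover have "\<not> connected_graph (induced G (?V - {s, p}))"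
            using nontriv[of t s p] st pV n by simp
          moreover then have "\<not> connected_graph (induced G (?V - {p, s}))" by (simp add: insert_commute)
          ultimately have "card (?N p) = 2" using split2[OF pV(1) tV(2) pV(2)] by blast
          then have "?m p t = 2" using full adjacent_sym[of G t p] pV(3) by simp
          then have mtp: "?m t p = 2" by (simp add: insert_commute)
          have "(\<Sum>w\<in>?N t - {s} - {p}. ?m t w) = 0"
            using rest mtp p finN[of t] by (simp add: sum.remove[of "?N t - {s}" p])
          moreover have "card (?N t - {s} - {p}) \<ge> 1"
            using \<open>card (?N t - {s}) \<ge> 2\<close> p finN[of t] by (subst card_Diff_singleton) auto
          then obtain q where "q \<in> ?N t - {s} - {p}" by (metis card.empty ex_in_conv not_one_le_zero)
          ultimately show False using mpos[of t q] finN[of t] by simp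
        qed
        have "insert t (?N t - {s}) \<subseteq> ?N s" using nb s(2) by auto
        then have "card (insert t (?N t - {s})) \<le> 2" using card_mono[OF finN] s(1) by metis
        moreover have "t \<notin> ?N t - {s}" using adjacentD(3)[OF G(1)] by blast
        ultimately show False using \<open>card (?N t - {s}) \<ge> 2\<close> finN[of t] by simp
      qed
      show ?thesis
      proof (rule ccontr)
        assume n: "card (?N v) \<noteq> 2"
        have "reachable G x v" using conn 3(1) v by (rule connected_reachable)
        then obtain s t where "card (?N s) = 2" "card (?N t) \<noteq> 2" "adjacent G s t"
          using reachable_cut[of G x v "{s. card (?N s) = 2}"] n x2 by auto
        then show False using step by blast
      qed
    qed
    then show ?thesis by (rule bad_lists_two_regular_brick[OF G bad _ reg r])
  qed
qed

subsection \<open>Bad lists for bricks\<close>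

lemma card_incident_le:
  assumes "bij_betw (ends G) D F" "finite {f \<in> F. v \<in> f}"
  shows "card {e \<in> D. v \<in> ends G e} \<le> card {f \<in> F. v \<in> f}"
proof (rule card_inj_on_le)
  show "inj_on (ends G) {e \<in> D. v \<in> ends G e}"
    using assms(1) by (auto simp: bij_betw_def intro: inj_on_subset)
  show "ends G ` {e \<in> D. v \<in> ends G e} \<subseteq> {f \<in> F. v \<in> f}" using assms(1) by (auto simp: bij_betw_def)
qed (rule assms(2))

lemma complete_edges_incident:
  assumes "finite V" "v \<in> V"
  shows "finite {f \<in> complete_edges V. v \<in> f}" "card {f \<in> complete_edges V. v \<in> f} \<le> card V - 1"
proof -
  have sub: "{f \<in> complete_edges V. v \<in> f} \<subseteq> (\<lambda>w. {v, w}) ` (V - {v})"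
    unfolding complete_edges_def by blast
  show "finite {f \<in> complete_edges V. v \<in> f}" by (rule finite_subset[OF sub]) (use assms(1) in simp)
  have "card {f \<in> complete_edges V. v \<in> f} \<le> card ((\<lambda>w. {v, w}) ` (V - {v}))"
    using sub assms(1) by (intro card_mono) auto
  also have "\<dots> \<le> card (V - {v})" using assms(1) by (intro card_image_le) simp
  finally show "card {f \<in> complete_edges V. v \<in> f} \<le> card V - 1" using assms by simp
qed

lemma cycle_incident_index:
  assumes "distinct vs" "length vs = n" "i < n" "j < n" "vs ! i \<in> {vs ! j, vs ! (Suc j mod n)}"
  shows "j = i \<or> j = (if i = 0 then n - 1 else i - 1)"
proof -
  have "Suc j mod n < n" using assms(4) by simp
  then have "i = j \<or> i = Suc j mod n" using assms by (auto simp: nth_eq_iff_index_eq)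
  then show ?thesis using assms(3,4) by (auto simp: Suc_mod_cases split: if_splits)
qed

lemma cycle_edges_incident:
  assumes "distinct vs" "v \<in> set vs"
  shows "finite {f \<in> cycle_edges vs. v \<in> f}" "card {f \<in> cycle_edges vs. v \<in> f} \<le> 2"
proof -
  obtain i where i: "i < length vs" "v = vs ! i" using assms(2) by (auto simp: in_set_conv_nth)
  define m where "m = (if i = 0 then length vs - 1 else i - 1)"
  let ?f = "\<lambda>i. {vs ! i, vs ! (Suc i mod length vs)}"
  have sub: "{f \<in> cycle_edges vs. v \<in> f} \<subseteq> {?f i, ?f m}"
    using cycle_incident_index[OF assms(1) refl i(1)] unfolding cycle_edges_def i(2) m_def by blast
  then show "finite {f \<in> cycle_edges vs. v \<in> f}" by (rule finite_subset) simp
  have "card {f \<in> cycle_edges vs. v \<in> f} \<le> card {?f i, ?f m}" using sub by (intro card_mono) auto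
  also have "\<dots> \<le> 2" by (simp add: card_insert_if)
  finally show "card {f \<in> cycle_edges vs. v \<in> f} \<le> 2" .
qed

lemma degree_doubled:
  assumes "signed_graph G" "doubled G V F" "finite {f \<in> F. v \<in> f}"
  shows "degree G v \<le> 2 * card {f \<in> F. v \<in> f}"
proof -
  have eq: "{e \<in> edges G. v \<in> ends G e} = {e \<in> {e \<in> edges G. esign G e = 1}. v \<in> ends G e} \<union>
      {e \<in> {e \<in> edges G. esign G e = -1}. v \<in> ends G e}"
    using signed_graphD(3)[OF assms(1)] by auto
  have "degree G v \<le> card {e \<in> {e \<in> edges G. esign G e = 1}. v \<in> ends G e} +
      card {e \<in> {e \<in> edges G. esign G e = -1}. v \<in> ends G e}"
    unfolding degree_def by (rule order_trans[OF eq_refl[OF arg_cong[OF eq, of card]] card_Un_le])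
  then show ?thesis
    using card_incident_le[of G "{e \<in> edges G. esign G e = 1}" F v]
      card_incident_le[of G "{e \<in> edges G. esign G e = -1}" F v] assms(2,3)
    unfolding doubled_def by linarith
qed

text \<open>Edges of both signs exclude \<open>\<phi> w\<close> and \<open>- \<phi> w\<close>, so
  the absolute values of a coloring of a doubled graph properly color the simple graph.\<close>

lemma doubled_coloring:
  assumes "signed_graph G" "doubled G V F" "{v, w} \<in> F" "coloring G \<phi>"
  shows "\<bar>\<phi> v\<bar> \<noteq> \<bar>\<phi> w\<bar>"
proof -
  have "{v, w} \<in> ends G ` {e \<in> edges G. esign G e = 1}" "{v, w} \<in> ends G ` {e \<in> edges G. esign G e = -1}"
    using assms(2,3) by (auto simp: doubled_def bij_betw_def)
  then obtain e e' where e: "e \<in> edges G" "ends G e = {v, w}" "esign G e = 1"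
    "e' \<in> edges G" "ends G e' = {v, w}" "esign G e' = -1" by auto
  then have "\<phi> v \<noteq> esign G e * \<phi> w" "\<phi> v \<noteq> esign G e' * \<phi> w"
    using assms(4) unfolding coloring_def by blast+
  then show ?thesis using e by (auto simp: abs_eq_iff)
qed

text \<open>Balance is applied to the triangles \<open>v\<close>, \<open>u\<close>,
  \<open>w\<close>, realized as cycles of length 3 by explicit lists.\<close>

lemma balanced_complete_potential:
  assumes G: "signed_graph G" and simple: "underlying_simple G V (complete_edges V)" and bal: "balanced G"
    and v0: "v0 \<in> V"
  obtains s where "\<And>v. v \<in> V \<Longrightarrow> s v = 1 \<or> s v = (-1::int)"
    "\<And>e v w. e \<in> edges G \<Longrightarrow> ends G e = {v, w} \<Longrightarrow> esign G e = s v * s w"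
proof -
  have V: "verts G = V" using simple by (simp add: underlying_simple_def)
  have inj: "e = e'" if "e \<in> edges G" "e' \<in> edges G" "ends G e = ends G e'" for e e'
    using simple that by (auto simp: underlying_simple_def bij_betw_def dest: inj_onD)
  have adj: "adjacent G v w" if "v \<in> verts G" "w \<in> verts G" "v \<noteq> w" for v w
  proof -
    have "{v, w} \<in> ends G ` edges G"
      using simple that by (auto simp: underlying_simple_def bij_betw_def complete_edges_def)
    then show ?thesis by (auto simp: adjacent_def)
  qed
  have tri: "esign G e = esign G e1 * esign G e2"
    if e: "e1 \<in> edges G" "ends G e1 = {v, u}" "e2 \<in> edges G" "ends G e2 = {v, w}"
      "e \<in> edges G" "ends G e = {u, w}" for e1 e2 e v u w
  proof -
    let ?C = "G\<lparr>verts := {v, u, w}, edges := {e1, e, e2}\<rparr>"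
    have d: "v \<noteq> u" "v \<noteq> w" "u \<noteq> w"
      using edge_ends_neq[OF G e(1,2)] edge_ends_neq[OF G e(3,4)] edge_ends_neq[OF G e(5,6)] by auto
    have inV: "v \<in> verts G" "u \<in> verts G" "w \<in> verts G"
      using signed_graphD(1)[OF G e(1)] signed_graphD(1)[OF G e(3)] e by auto
    have ne: "e1 \<noteq> e" "e1 \<noteq> e2" "e \<noteq> e2" using e d by (auto simp: doubleton_eq_iff)
    have "subgraph ?C G" using G e inV by (auto simp: subgraph_def signed_graph_def)
    moreover have "cycle_graph 3 ?C"
      unfolding cycle_graph_def
    proof (intro conjI exI[of _ "[v, u, w]"] exI[of _ "[e1, e, e2]"] allI impI)
      fix i :: nat assume "i < 3"
      then have "i = 0 \<or> i = 1 \<or> i = 2" by auto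
      then show "ends ?C ([e1, e, e2] ! i) = {[v, u, w] ! i, [v, u, w] ! (Suc i mod 3)}"
        using e by (auto simp: insert_commute)
    qed (use ne d in auto)
    ultimately have "sign_product ?C > 0" using bal unfolding balanced_def by blast
    then have "esign G e1 * esign G e * esign G e2 > 0" using ne by (simp add: sign_product_def mult.assoc)
    then show ?thesis
      using signed_graphD(3)[OF G e(1)] signed_graphD(3)[OF G e(3)] signed_graphD(3)[OF G e(5)] by auto
  qed
  have "v0 \<in> verts G" using v0 V by simp
  then obtain s where "\<And>v. v \<in> V \<Longrightarrow> s v = 1 \<or> s v = (-1::int)"
    "\<And>e v w. e \<in> edges G \<Longrightarrow> ends G e = {v, w} \<Longrightarrow> esign G e = s v * s w"
    unfolding V[symmetric]
    by (rule complete_triangle_potential[OF G _ inj adj tri]) blast+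
  then show thesis by (rule that)
qed

text \<open>After switching by the potential this is the ordinary complete graph with the same
  \<open>card V - 1\<close> colors at every vertex, which admits no coloring by the pigeonhole
  principle.\<close>

lemma balanced_complete_bad_lists:
  assumes G: "signed_graph G" and simple: "underlying_simple G V (complete_edges V)" and bal: "balanced G"
    and V: "finite V" "V \<noteq> {}"
  shows "\<exists>L. bad_lists G L \<and> (\<forall>v\<in>verts G. 0 \<notin> L v)"
proof -
  have vG: "verts G = V" using simple by (simp add: underlying_simple_def)
  obtain s where s: "\<And>v. v \<in> V \<Longrightarrow> s v = 1 \<or> s v = (-1::int)"
    and pot: "\<And>e v w. e \<in> edges G \<Longrightarrow> ends G e = {v, w} \<Longrightarrow> esign G e = s v * s w"
    using balanced_complete_potential[OF G simple bal] V(2) by blast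
  let ?K = "{1..int (card V - 1)}"
  define L where "L v = (\<lambda>c. s v * c) ` ?K" for v
  have "bad_lists G L"
    unfolding bad_lists_def
  proof (intro conjI ballI notI)
    fix v assume "v \<in> verts G"
    then have v: "v \<in> V" using vG by simp
    show "finite (L v)" by (simp add: L_def)
    have "inj_on (\<lambda>c. s v * c) ?K" using s[OF v] by (auto simp: inj_on_def)
    then have "card (L v) = card V - 1" unfolding L_def by (subst card_image) auto
    moreover have "degree G v \<le> card V - 1"
      using card_incident_le[of G "edges G" "complete_edges V" v] complete_edges_incident[OF V(1) v] simple
      unfolding degree_def underlying_simple_def by linarith
    ultimately show "degree G v \<le> card (L v)" by simp
  next
    assume "\<exists>\<phi>. list_coloring G L \<phi>"
    then obtain \<phi> where \<phi>: "coloring G \<phi>" "\<And>v. v \<in> V \<Longrightarrow> \<phi> v \<in> L v"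
      using vG by (auto simp: list_coloring_def)
    have "inj_on (\<lambda>v. s v * \<phi> v) V"
    proof (rule inj_onI, rule ccontr)
      fix v w assume vw: "v \<in> V" "w \<in> V" "s v * \<phi> v = s w * \<phi> w" "v \<noteq> w"
      then have "{v, w} \<in> ends G ` edges G"
        using simple by (auto simp: underlying_simple_def bij_betw_def complete_edges_def)
      then obtain e where e: "e \<in> edges G" "ends G e = {v, w}" by auto
      then have "\<phi> v \<noteq> esign G e * \<phi> w" using \<phi>(1) unfolding coloring_def by blast
      then show False using pot[OF e] s[OF vw(1)] s[OF vw(2)] vw(3) by auto
    qed
    moreover have "(\<lambda>v. s v * \<phi> v) ` V \<subseteq> ?K"
    proof
      fix c assume "c \<in> (\<lambda>v. s v * \<phi> v) ` V"
      then obtain v where v: "v \<in> V" "c = s v * \<phi> v" by blast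
      then obtain d where "d \<in> ?K" "\<phi> v = s v * d" using \<phi>(2)[of v] by (auto simp: L_def)
      then show "c \<in> ?K" using v s[OF v(1)] by auto
    qed
    ultimately have "card V \<le> card ?K" by (intro card_inj_on_le[of _ V ?K]) auto
    then show False using card_gt_0_iff[of V] V by simp
  qed
  moreover have "0 \<notin> L v" if "v \<in> verts G" for v using s that vG by (force simp: L_def)
  ultimately show ?thesis by blast
qed

text \<open>Only \<open>card V - 1\<close> absolute values are available for vertices whose absolute
  values must be pairwise different; taking both signs of each makes the lists long enough for the
  doubled degree.\<close>

lemma doubled_complete_bad_lists:
  assumes G: "signed_graph G" and dbl: "doubled G V (complete_edges V)" and V: "finite V" "V \<noteq> {}"
  shows "\<exists>L. bad_lists G L \<and> (\<forall>v\<in>verts G. 0 \<notin> L v)"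
proof -
  have vG: "verts G = V" using dbl by (simp add: doubled_def)
  let ?k = "int (card V - 1)"
  define L where "L v = {-?k..?k} - {0}" for v :: 'a
  have "bad_lists G L"
    unfolding bad_lists_def
  proof (intro conjI ballI notI)
    fix v assume "v \<in> verts G"
    then have v: "v \<in> V" using vG by simp
    show "finite (L v)" by (simp add: L_def)
    have "card (L v) = 2 * (card V - 1)" by (simp add: L_def)
    moreover have "degree G v \<le> 2 * (card V - 1)"
      using degree_doubled[OF G dbl complete_edges_incident(1)[OF V(1) v]]
        complete_edges_incident(2)[OF V(1) v] by linarith
    ultimately show "degree G v \<le> card (L v)" by simp
  next
    assume "\<exists>\<phi>. list_coloring G L \<phi>"
    then obtain \<phi> where \<phi>: "coloring G \<phi>" "\<And>v. v \<in> V \<Longrightarrow> \<phi> v \<in> L v"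
      using vG by (auto simp: list_coloring_def)
    have "inj_on (\<lambda>v. \<bar>\<phi> v\<bar>) V"
    proof (rule inj_onI, rule ccontr)
      fix v w assume vw: "v \<in> V" "w \<in> V" "\<bar>\<phi> v\<bar> = \<bar>\<phi> w\<bar>" "v \<noteq> w"
      then have "{v, w} \<in> complete_edges V" by (auto simp: complete_edges_def)
      then show False using doubled_coloring[OF G dbl _ \<phi>(1)] vw(3) by blast
    qed
    moreover have "(\<lambda>v. \<bar>\<phi> v\<bar>) ` V \<subseteq> {1..?k}" using \<phi>(2) by (force simp: L_def)
    ultimately have "card V \<le> card {1..?k}" by (intro card_inj_on_le[of _ V]) auto
    then show False using card_gt_0_iff[of V] V by simp
  qed
  then show ?thesis by (auto simp: L_def)
qed

text \<open>The colors have only the absolute values 1 and 2, which would have to alternate around a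
  cycle of odd length.\<close>

lemma doubled_odd_cycle_bad_lists:
  assumes G: "signed_graph G" and dbl: "doubled G (set vs) (cycle_edges vs)"
    and vs: "distinct vs" "odd (length vs)"
  shows "\<exists>L. bad_lists G L \<and> (\<forall>v\<in>verts G. 0 \<notin> L v)"
proof -
  define n where "n = length vs"
  have vG: "verts G = set vs" using dbl by (simp add: doubled_def)
  define L where "L v = {-2..2::int} - {0}" for v :: 'a
  have "bad_lists G L"
    unfolding bad_lists_def
  proof (intro conjI ballI notI)
    fix v assume "v \<in> verts G"
    then have v: "v \<in> set vs" using vG by simp
    show "finite (L v)" by (simp add: L_def)
    have "card (L v) = 4" by (simp add: L_def)
    then show "degree G v \<le> card (L v)"
      using degree_doubled[OF G dbl cycle_edges_incident(1)[OF vs(1) v]]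
        cycle_edges_incident(2)[OF vs(1) v] by linarith
  next
    assume "\<exists>\<phi>. list_coloring G L \<phi>"
    then obtain \<phi> where \<phi>: "coloring G \<phi>" "\<And>v. v \<in> set vs \<Longrightarrow> \<phi> v \<in> L v"
      using vG by (auto simp: list_coloring_def)
    have two: "\<bar>\<phi> (vs ! i)\<bar> = 1 \<or> \<bar>\<phi> (vs ! i)\<bar> = 2" if "i < n" for i
      using \<phi>(2)[of "vs ! i"] that by (auto simp: L_def n_def)
    have neq: "\<bar>\<phi> (vs ! i)\<bar> \<noteq> \<bar>\<phi> (vs ! (Suc i mod n))\<bar>" if "i < n" for i
    proof -
      have "{vs ! i, vs ! (Suc i mod n)} \<in> cycle_edges vs" using that by (auto simp: cycle_edges_def n_def)
      then show ?thesis by (rule doubled_coloring[OF G dbl _ \<phi>(1)])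
    qed
    have alt: "\<bar>\<phi> (vs ! i)\<bar> = \<bar>\<phi> (vs ! 0)\<bar> \<longleftrightarrow> even i" if "i < n" for i
      using that
    proof (induction i)
      case (Suc i)
      then have "\<bar>\<phi> (vs ! i)\<bar> = \<bar>\<phi> (vs ! 0)\<bar> \<longleftrightarrow> even i" by simp
      moreover have "\<bar>\<phi> (vs ! i)\<bar> \<noteq> \<bar>\<phi> (vs ! Suc i)\<bar>" using neq[of i] Suc.prems by simp
      ultimately show ?case using two[of i] two[of "Suc i"] two[of 0] Suc.prems by auto
    qed simp
    have "n > 0" "odd n" using vs(2) by (auto simp: n_def odd_pos)
    then show False using alt[of "n - 1"] neq[of "n - 1"] by simp
  qed
  then show ?thesis by (auto simp: L_def)
qed

text \<open>With values 1 and -1, a properly colored edge determines the value at one end as minus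
  its sign times the value at the other. Multiplying around the cycle, the vertex values cancel and
  \<open>(-1) ^ n * P = 1\<close> remains, which contradicts the parity condition of a
  brick.\<close>

lemma simple_cycle_bad_lists:
  assumes G: "signed_graph G" and n: "n \<ge> 2" "length vs = n" "length es = n" "distinct vs" "distinct es"
    "verts G = set vs" "edges G = set es"
    "\<And>i. i < n \<Longrightarrow> ends G (es ! i) = {vs ! i, vs ! (Suc i mod n)}"
    and odd: "odd n \<longleftrightarrow> balanced G"
  shows "\<exists>L. bad_lists G L \<and> (\<forall>v\<in>verts G. 0 \<notin> L v)"
proof -
  define L where "L v = {1, -1::int}" for v :: 'a
  have "bad_lists G L"
    unfolding bad_lists_def
  proof (intro conjI ballI notI)
    fix v assume "v \<in> verts G"
    then obtain i where i: "i < n" "v = vs ! i" using n(2,6) by (auto simp: in_set_conv_nth)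
    define m where "m = (if i = 0 then n - 1 else i - 1)"
    show "finite (L v)" by (simp add: L_def)
    have "{e \<in> edges G. v \<in> ends G e} \<subseteq> {es ! i, es ! m}"
    proof
      fix e assume e: "e \<in> {e \<in> edges G. v \<in> ends G e}"
      then obtain j where j: "j < n" "e = es ! j" using n(3,7) by (auto simp: in_set_conv_nth)
      then have "vs ! i \<in> {vs ! j, vs ! (Suc j mod n)}" using e i(2) n(8) by auto
      then show "e \<in> {es ! i, es ! m}"
        using cycle_incident_index[OF n(4,2) i(1) j(1)] j(2) by (auto simp: m_def)
    qed
    then have "degree G v \<le> card {es ! i, es ! m}" unfolding degree_def by (intro card_mono) auto
    also have "\<dots> \<le> 2" by (simp add: card_insert_if)
    finally show "degree G v \<le> card (L v)" by (simp add: L_def)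
  next
    assume "\<exists>\<phi>. list_coloring G L \<phi>"
    then obtain \<phi> where \<phi>: "coloring G \<phi>" "\<And>v. v \<in> set vs \<Longrightarrow> \<phi> v \<in> L v"
      using n(6) by (auto simp: list_coloring_def)
    let ?a = "\<lambda>i. \<phi> (vs ! i)"
    have a1: "?a i = 1 \<or> ?a i = -1" if "i < n" for i
      using \<phi>(2)[of "vs ! i"] that n(2) by (simp add: L_def)
    have step: "?a i = (-1) * esign G (es ! i) * ?a (Suc i mod n)" if i: "i < n" for i
    proof -
      have e: "es ! i \<in> edges G" using n i by simp
      then have "?a i \<noteq> esign G (es ! i) * ?a (Suc i mod n)"
        using \<phi>(1) n(8)[OF i] unfolding coloring_def by blast
      moreover have "Suc i mod n < n" using i by simp
      ultimately show ?thesis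
        using a1[OF i] a1[of "Suc i mod n"] signed_graphD(3)[OF G e] by auto
    qed
    define P where "P = (\<Prod>i<n. esign G (es ! i))"
    define A where "A = (\<Prod>i<n. ?a i)"
    have P1: "P = 1 \<or> P = -1"
      unfolding P_def using signed_graphD(3)[OF G] n by (intro prod_sign) auto
    have A1: "A = 1 \<or> A = -1" unfolding A_def using a1 by (intro prod_sign)
    have "A = (\<Prod>i<n. (-1) * esign G (es ! i) * ?a (Suc i mod n))"
      unfolding A_def by (rule prod.cong[OF refl], rule step) simp
    also have "\<dots> = (-1) ^ n * P * (\<Prod>i<n. ?a (Suc i mod n))"
      unfolding P_def prod.distrib by simp
    also have "(\<Prod>i<n. ?a (Suc i mod n)) = A"
      unfolding A_def by (rule prod.reindex_bij_betw[OF bij_betw_Suc_mod])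
    finally have "(-1) ^ n * P = 1" using A1 by auto
    then have "odd n \<longleftrightarrow> P = -1" using P1 by (cases "odd n") auto
    then show False using odd cycle_balanced_iff[OF G n] P1 by (auto simp: P_def)
  qed
  then show ?thesis by (auto simp: L_def)
qed

lemma brick_bad_lists:
  assumes "brick G"
  shows "\<exists>L. bad_lists G L \<and> (\<forall>v\<in>verts G. 0 \<notin> L v)"
proof -
  have G: "signed_graph G" using assms by (simp add: brick_def)
  have cyc: ?thesis if c: "cycle_graph n G" and o: "odd n \<longleftrightarrow> balanced G" for n
  proof -
    obtain vs es where n: "n \<ge> 2" "length vs = n" "length es = n" "distinct vs" "distinct es"
      "verts G = set vs" "edges G = set es"
      "\<And>i. i < n \<Longrightarrow> ends G (es ! i) = {vs ! i, vs ! (Suc i mod n)}"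
      using c by (auto simp: cycle_graph_def)
    show ?thesis by (rule simple_cycle_bad_lists[OF G n o])
  qed
  consider n where "n \<ge> 1" "complete_graph n G" "balanced G"
    | n where "cycle_graph n G" "odd n \<longleftrightarrow> balanced G"
    | n where "n \<ge> 2" "doubled_complete n G"
    | n where "odd n" "doubled_cycle n G"
    using assms unfolding brick_def by blast
  then show ?thesis
  proof cases
    case 1
    then obtain V where V: "finite V" "card V = n" "underlying_simple G V (complete_edges V)"
      by (auto simp: complete_graph_def)
    then have "V \<noteq> {}" using 1(1) by auto
    then show ?thesis using balanced_complete_bad_lists[OF G V(3) 1(3) V(1)] by blast
  next
    case 2
    then show ?thesis by (rule cyc)
  next
    case 3
    then obtain V where V: "finite V" "card V = n" "doubled G V (complete_edges V)"
      by (auto simp: doubled_complete_def)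
    then have "V \<noteq> {}" using 3(1) by auto
    then show ?thesis using doubled_complete_bad_lists[OF G V(3,1)] by blast
  next
    case 4
    then show ?thesis using doubled_odd_cycle_bad_lists[OF G] by (auto simp: doubled_cycle_def)
  qed
qed

subsection \<open>Blocks and gluing\<close>

lemma subgraph_trans: "subgraph A B \<Longrightarrow> subgraph B C \<Longrightarrow> subgraph A C"
  by (auto simp: subgraph_def)

lemma subgraph_induced:
  assumes "subgraph H G" "verts H \<subseteq> U"
  shows "subgraph H (induced G U)"
proof -
  have "ends H e \<subseteq> U" if "e \<in> edges H" for e
    using that assms signed_graphD(1)[of H e] by (auto simp: subgraph_def)
  then show ?thesis using assms by (auto simp: subgraph_def)
qed

lemma induced_subgraph: "signed_graph G \<Longrightarrow> U \<subseteq> verts G \<Longrightarrow> subgraph (induced G U) G"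
  by (auto simp: subgraph_def)

lemma subgraph_adjacent: "subgraph H G \<Longrightarrow> adjacent H a b \<Longrightarrow> adjacent G a b"
  by (auto simp: subgraph_def adjacent_def)

text \<open>Extra edges on the same vertex set cannot destroy connectedness, neither of the whole
  nor after deleting a vertex.\<close>

lemma nonseparable_supergraph:
  assumes H: "signed_graph H" and sub: "subgraph B H" "verts B = verts H" and B: "nonseparable B"
  shows "nonseparable H"
proof -
  have sB: "signed_graph B" using sub by (simp add: subgraph_def)
  have "reachable H x y" if "x \<in> verts H" "y \<in> verts H" for x y
    using connected_reachable[OF nonseparable_connected[OF B], of x y] that sub(2)
    by (auto intro: reachable_mono subgraph_adjacent[OF sub(1)])
  moreover have "verts H \<noteq> {}" using B sub(2) by (auto simp: nonseparable_def connected_graph_def)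
  ultimately have conn: "connected_graph H" by (simp add: connected_graph_def)
  have "\<not> separating_vertex H v" for v
  proof
    assume "separating_vertex H v"
    then obtain x y where xy: "v \<in> verts H" "x \<in> verts H - {v}" "y \<in> verts H - {v}"
      "\<not> reachable (induced H (verts H - {v})) x y"
      unfolding separating_vertex_def remove_vertex_induced[OF H] by blast
    have "x \<in> verts B" "v \<noteq> x" "v \<in> verts B" using xy sub(2) by auto
    then have "connected_graph (induced B (verts B - {v}))" using nonseparable_remove[OF sB B] by blast
    then have "reachable (induced B (verts B - {v})) x y"
      by (rule connected_reachable) (use xy sub(2) in auto)
    then have "reachable (induced H (verts H - {v})) x y"
      by (rule reachable_mono) (use sub(2) in \<open>auto simp: adjacent_induced intro: subgraph_adjacent[OF sub(1)]\<close>)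
    then show False using xy by blast
  qed
  then show ?thesis using conn by (simp add: nonseparable_def)
qed

text \<open>Filling in all edges on its vertices keeps a block nonseparable, so maximality forces
  equality. This lets \<open>bad_lists_induced\<close>, which speaks of vertex sets, be applied to
  blocks.\<close>

lemma block_eq_induced:
  assumes G: "signed_graph G" and B: "block B G"
  shows "B = induced G (verts B)"
proof -
  have sub: "subgraph B G" "nonseparable B"
    and max: "\<And>H. subgraph H G \<Longrightarrow> nonseparable H \<Longrightarrow> subgraph B H \<Longrightarrow> H = B"
    using B by (auto simp: block_def)
  have V: "verts B \<subseteq> verts G" using sub by (simp add: subgraph_def)
  have "subgraph B (induced G (verts B))" using subgraph_induced[OF sub(1)] by simp
  moreover then have "nonseparable (induced G (verts B))"
    using nonseparable_supergraph[of "induced G (verts B)" B] G V sub(2) by simp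
  ultimately show ?thesis using max induced_subgraph[OF G V] by metis
qed

lemma block_refl:
  assumes G: "signed_graph G" "nonseparable G"
  shows "block G G"
proof -
  have "H = G" if "subgraph H G" "subgraph G H" for H
    by (rule sgraph.equality) (use that in \<open>auto simp: subgraph_def\<close>)
  moreover have "subgraph G G" using G by (simp add: subgraph_def)
  ultimately show ?thesis using G unfolding block_def by blast
qed

text \<open>\<open>v\<close> is the only exit from \<open>U\<close>, so a walk in \<open>G\<close>
  from \<open>U\<close> towards \<open>v\<close> stays in \<open>U\<close> until it arrives.\<close>

lemma connected_induced_attached:
  assumes G: "signed_graph G" "connected_graph G" and v: "v \<in> verts G" and U: "U \<subseteq> verts G" "v \<in> U"
    and attached: "\<And>a b. adjacent G a b \<Longrightarrow> a \<in> U - {v} \<Longrightarrow> b \<in> U"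
  shows "connected_graph (induced G U)"
proof (rule connected_graphI[of v])
  show "v \<in> verts (induced G U)" using U by simp
  fix z assume "z \<in> verts (induced G U)"
  then have z: "z \<in> U" by simp
  show "reachable (induced G U) z v"
  proof (rule ccontr)
    assume n: "\<not> ?thesis"
    let ?S = "{s. reachable (induced G U) z s}"
    have sg: "signed_graph (induced G U)" using G U by simp
    have "reachable G z v" using G(2) z U by (intro connected_reachable) auto
    then obtain s t where st: "reachable (induced G U) z s" "\<not> reachable (induced G U) z t" "adjacent G s t"
      using reachable_cut[of G z v ?S] n by auto
    have "s \<in> U" using reachable_verts[OF sg st(1)] z by simp
    moreover have "s \<noteq> v" using st(1) n by blast
    ultimately have "t \<in> U" using attached[OF st(3)] by simp
    then have "adjacent (induced G U) s t" using st(3) \<open>s \<in> U\<close> by (simp add: adjacent_induced)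
    then show False using st reachable_step by metis
  qed
qed

text \<open>Otherwise \<open>v\<close> would separate a vertex of the subgraph in \<open>U\<close>
  from one outside \<open>U\<close>.\<close>

lemma nonseparable_on_one_side:
  assumes G: "signed_graph G" and H: "subgraph H G" "nonseparable H"
    and sep: "\<And>a b. adjacent G a b \<Longrightarrow> a \<in> U - {v} \<Longrightarrow> b \<in> U"
  shows "verts H \<subseteq> U \<or> verts H \<inter> U \<subseteq> {v}"
proof (rule ccontr)
  assume "\<not> ?thesis"
  then obtain a b where ab: "a \<in> verts H" "a \<in> U - {v}" "b \<in> verts H" "b \<notin> U" by blast
  have sH: "signed_graph H" using H by (simp add: subgraph_def)
  show False
  proof (cases "b = v")
    \<comment> \<open>Here \<open>v\<close> lies outside \<open>U\<close>, so no edge leaves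
      \<open>U\<close> at all.\<close>
    case True
    have "reachable H a b" using nonseparable_connected[OF H(2)] ab(1,3) by (rule connected_reachable)
    then obtain s t where st: "s \<in> U - {v}" "t \<notin> U - {v}" "adjacent H s t"
      using reachable_cut[of H a b "U - {v}"] ab by blast
    then have "t \<in> U" using sep subgraph_adjacent[OF H(1)] by blast
    then show False using st True ab by auto
  next
    case False
    have "reachable (induced H (verts H - {v})) a b"
    proof (cases "v \<in> verts H")
      case True
      have "a \<noteq> v" using ab by simp
      then have "connected_graph (induced H (verts H - {v}))"
        using nonseparable_remove[OF sH H(2) True ab(1)] by simp
      then show ?thesis by (rule connected_reachable) (use ab False in auto)
    next
      case nv: False
      have "reachable H a b" using nonseparable_connected[OF H(2)] ab(1,3) by (rule connected_reachable)
      then show ?thesis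
        by (rule reachable_mono) (use nv adjacentD[OF sH] in \<open>auto simp: adjacent_induced\<close>)
    qed
    then obtain s t where st: "s \<in> U - {v}" "t \<notin> U - {v}" "adjacent (induced H (verts H - {v})) s t"
      using reachable_cut[of _ a b "U - {v}"] ab by blast
    then have "t \<in> U" "t \<noteq> v" using sep subgraph_adjacent[OF H(1)] by (auto simp: adjacent_induced)
    then show False using st by blast
  qed
qed

text \<open>Serves to show that an isolated vertex is not a block where an edge is present. Deleting
  one of two vertices leaves nothing to separate.\<close>

lemma nonseparable_edge:
  assumes G: "signed_graph G" and e: "e \<in> edges G"
  defines "K \<equiv> G\<lparr>verts := ends G e, edges := {e}\<rparr>"
  shows "subgraph K G" "nonseparable K"
proof -
  obtain a b where ab: "ends G e = {a, b}" "a \<noteq> b"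
    using signed_graphD(2)[OF G e] by (auto simp: card_2_iff)
  show sub: "subgraph K G" using G e ab by (auto simp: subgraph_def signed_graph_def K_def)
  have "adjacent K a b" using ab by (simp add: adjacent_def K_def)
  then have "reachable K a b" "reachable K b a" using reachable_adjacent reachable_sym by metis+
  then have "connected_graph K" using ab by (auto simp: connected_graph_def K_def)
  moreover have "\<not> separating_vertex K v" for v
    using ab by (auto simp: separating_vertex_def K_def)
  ultimately show "nonseparable K" by (simp add: nonseparable_def)
qed

text \<open>A nonseparable graph containing \<open>B\<close> but not contained in \<open>U\<close>
  meets \<open>U\<close> at most in \<open>v\<close>, so \<open>B\<close> would be the vertex
  \<open>v\<close> alone. But \<open>u\<close> forces an edge at \<open>v\<close> inside
  \<open>U\<close>, and that edge contradicts the maximality of \<open>B\<close>.\<close>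

lemma block_of_side:
  assumes G: "signed_graph G" "connected_graph G" and U: "U \<subseteq> verts G" "v \<in> U" "u \<in> U" "u \<noteq> v"
    and sep: "\<And>a b. adjacent G a b \<Longrightarrow> a \<in> U - {v} \<Longrightarrow> b \<in> U"
    and B: "block B (induced G U)"
  shows "block B G"
proof -
  let ?G = "induced G U"
  have sg: "signed_graph ?G" using G(1) U(1) by simp
  have sub: "subgraph B ?G" "nonseparable B"
    and max: "\<And>H. subgraph H ?G \<Longrightarrow> nonseparable H \<Longrightarrow> subgraph B H \<Longrightarrow> H = B"
    using B by (auto simp: block_def)
  have BU: "verts B \<subseteq> U" using sub(1) by (simp add: subgraph_def)
  have sB: "signed_graph B" using sub(1) by (simp add: subgraph_def)
  have nonempty: "verts B \<noteq> {}" using sub(2) by (simp add: nonseparable_def connected_graph_def)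
  have "H = B" if H: "subgraph H G" "nonseparable H" "subgraph B H" for H
  proof (cases "verts H \<subseteq> U")
    case True
    then show ?thesis using max subgraph_induced[OF H(1)] H by blast
  next
    case False
    then have "verts H \<inter> U \<subseteq> {v}" using nonseparable_on_one_side[OF G(1) H(1,2), of U v] sep by blast
    moreover have "verts B \<subseteq> verts H" using H(3) by (simp add: subgraph_def)
    ultimately have Bv: "verts B = {v}" using BU nonempty by blast
    have Be: "edges B = {}"
    proof -
      have "e \<notin> edges B" for e using signed_graphD(1,2)[OF sB, of e] Bv card_mono[of "{v}" "ends B e"] by auto
      then show ?thesis by blast
    qed
    have "connected_graph ?G" using U by (intro connected_induced_attached[OF G _ U(1,2) sep]) auto
    then have "reachable ?G v u" by (rule connected_reachable) (use U in auto)
    then obtain t where "adjacent ?G v t" using reachable_cut[of ?G v u "{v}"] U(4) by blast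
    then obtain e where e: "e \<in> edges ?G" "ends ?G e = {v, t}" by (auto simp: adjacent_def)
    let ?K = "?G\<lparr>verts := ends ?G e, edges := {e}\<rparr>"
    have "subgraph B ?K"
      using sub(1) sB Bv Be e(2) by (simp add: subgraph_def)
    then have "?K = B" using max nonseparable_edge[OF sg e(1)] by blast
    then have "edges ?K = edges B" by simp
    then show ?thesis using Be by simp
  qed
  moreover have "subgraph B G" using subgraph_trans[OF sub(1) induced_subgraph[OF G(1) U(1)]] .
  ultimately show ?thesis using sub(2) by (simp add: block_def)
qed

section \<open>Scaling lists and gluing them at a cut vertex\<close>

lemma bad_lists_scale:
  assumes G: "signed_graph G" and bad: "bad_lists G L" and k: "(k::int) \<noteq> 0"
  shows "bad_lists G (\<lambda>v. (\<lambda>c. k * c) ` L v)"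
  unfolding bad_lists_def
proof (intro conjI ballI notI)
  fix v assume v: "v \<in> verts G"
  have "inj_on (\<lambda>c. k * c) (L v)" using k by (simp add: inj_on_def)
  then show "degree G v \<le> card ((\<lambda>c. k * c) ` L v)" using bad v by (simp add: card_image bad_lists_def)
  show "finite ((\<lambda>c. k * c) ` L v)" using bad v by (simp add: bad_lists_def)
next
  assume "\<exists>\<phi>. list_coloring G (\<lambda>v. (\<lambda>c. k * c) ` L v) \<phi>"
  then obtain \<phi> where \<phi>: "coloring G \<phi>" "\<And>v. v \<in> verts G \<Longrightarrow> \<phi> v \<in> (\<lambda>c. k * c) ` L v"
    by (auto simp: list_coloring_def)
  have div: "\<phi> v div k \<in> L v" "\<phi> v = k * (\<phi> v div k)" if "v \<in> verts G" for v
    using \<phi>(2)[OF that] k by force+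
  have "coloring G (\<lambda>v. \<phi> v div k)"
    unfolding coloring_def
  proof (intro ballI allI impI notI)
    fix e v w assume e: "e \<in> edges G" "ends G e = {v, w}" "\<phi> v div k = esign G e * (\<phi> w div k)"
    have V: "v \<in> verts G" "w \<in> verts G" using signed_graphD(1)[OF G e(1)] e(2) by auto
    have "\<phi> v = k * (esign G e * (\<phi> w div k))" using div(2)[OF V(1)] e(3) by simp
    also have "\<dots> = esign G e * \<phi> w" using div(2)[OF V(2)] by (metis mult.left_commute)
    finally show False using \<phi>(1) e(1,2) unfolding coloring_def by blast
  qed
  then have "list_coloring G L (\<lambda>v. \<phi> v div k)" using div by (simp add: list_coloring_def)
  then show False using bad by (auto simp: bad_lists_def)
qed

lemma list_coloring_induced:
  assumes "coloring G \<phi>" "\<And>v. v \<in> U \<Longrightarrow> \<phi> v \<in> L v"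
  shows "list_coloring (induced G U) L \<phi>"
  using assms by (simp add: list_coloring_def coloring_def)

text \<open>At \<open>v\<close> the two lists are united, made disjoint by scaling one of them, so
  their sizes add up as the degrees do. A coloring would take its color at \<open>v\<close> from one
  of the lists and thereby color the corresponding side. Scaling by a nonzero integer commutes with
  signs and keeps lists bad.\<close>

lemma bad_lists_glue:
  assumes G: "signed_graph G" and v: "v \<in> verts G" and S: "S \<subseteq> verts G - {v}"
    and sep: "\<And>a b. adjacent G a b \<Longrightarrow> a \<in> S \<Longrightarrow> b \<in> insert v S"
    and bad1: "bad_lists (induced G (insert v S)) L1" and nz1: "\<And>z. z \<in> insert v S \<Longrightarrow> 0 \<notin> L1 z"
    and bad2: "bad_lists (induced G (verts G - S)) L2" and nz2: "\<And>z. z \<in> verts G - S \<Longrightarrow> 0 \<notin> L2 z"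
  shows "\<exists>L. bad_lists G L \<and> (\<forall>z\<in>verts G. 0 \<notin> L z)"
proof -
  let ?G1 = "induced G (insert v S)" and ?G2 = "induced G (verts G - S)"
  have finE: "finite (edges G)" using G by (simp add: signed_graph_def)
  have fin1: "finite (L1 v)" using bad1 by (simp add: bad_lists_def)
  \<comment> \<open>\<open>k\<close> exceeds the absolute value of every color in
    \<open>L1 v\<close>, while nonzero multiples of \<open>k\<close> have absolute value at least
    \<open>k\<close>. This is where the absence of 0 is used.\<close>
  define k where "k = 1 + (\<Sum>c\<in>L1 v. \<bar>c\<bar>)"
  have k1: "k \<ge> 1" by (simp add: k_def sum_nonneg)
  have klt: "\<bar>c\<bar> < k" if "c \<in> L1 v" for c
    using member_le_sum[OF that _ fin1, of abs] by (simp add: k_def)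
  define M where "M z = (\<lambda>c. k * c) ` L2 z" for z
  have badM: "bad_lists ?G2 M"
    unfolding M_def using bad_lists_scale[OF _ bad2, of k] G k1 by simp
  have nzM: "0 \<notin> M z" if "z \<in> verts G - S" for z using nz2[OF that] k1 by (auto simp: M_def)
  have vS: "v \<notin> S" using S by auto
  have disj: "L1 v \<inter> M v = {}"
  proof -
    have "k * d \<notin> L1 v" if "d \<in> L2 v" for d
    proof -
      have "d \<noteq> 0" using nz2[of v] v vS that by auto
      then have "\<bar>d\<bar> \<ge> 1" by simp
      then have "\<bar>k * d\<bar> \<ge> k" using k1 by (simp add: abs_mult)
      then show ?thesis using klt by force
    qed
    then show ?thesis by (auto simp: M_def)
  qed
  define L where "L z = (if z = v then L1 v \<union> M v else if z \<in> S then L1 z else M z)" for z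
  have side: "ends G e \<subseteq> insert v S \<or> ends G e \<subseteq> verts G - S" if e: "e \<in> edges G" for e
  proof -
    obtain a b where ab: "ends G e = {a, b}" using signed_graphD(2)[OF G e] by (auto simp: card_2_iff)
    then have "adjacent G a b" "adjacent G b a" using e by (auto simp: adjacent_def insert_commute)
    then show ?thesis using sep[of a b] sep[of b a] ab signed_graphD(1)[OF G e] by auto
  qed
  have "bad_lists G L"
    unfolding bad_lists_def
  proof (intro conjI ballI notI)
    fix z assume z: "z \<in> verts G"
    have f1: "finite (L1 z) \<and> degree ?G1 z \<le> card (L1 z)" if "z \<in> insert v S"
      using bad1 that by (auto simp: bad_lists_def)
    have f2: "finite (M z) \<and> degree ?G2 z \<le> card (M z)" if "z \<notin> S"
      using badM that z by (simp add: bad_lists_def)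
    show "finite (L z)" using f1 f2 vS by (auto simp: L_def)
    consider "z = v" | "z \<in> S" "z \<noteq> v" | "z \<notin> S" "z \<noteq> v" by blast
    then show "degree G z \<le> card (L z)"
    proof cases
      case 1
      have "{e \<in> edges G. z \<in> ends G e} \<subseteq>
          {e \<in> edges ?G1. z \<in> ends ?G1 e} \<union> {e \<in> edges ?G2. z \<in> ends ?G2 e}"
        using side by auto
      then have "degree G z \<le> card ({e \<in> edges ?G1. z \<in> ends ?G1 e} \<union> {e \<in> edges ?G2. z \<in> ends ?G2 e})"
        unfolding degree_def using finE by (intro card_mono) auto
      also have "\<dots> \<le> degree ?G1 z + degree ?G2 z" unfolding degree_def by (rule card_Un_le)
      also have "\<dots> \<le> card (L1 z) + card (M z)" using f1 f2 1 vS by (simp add: add_mono)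
      also have "\<dots> = card (L z)"
        using card_Un_disjoint[of "L1 v" "M v"] disj f1 f2 1 vS by (simp add: L_def)
      finally show ?thesis .
    next
      case 2
      have "{e \<in> edges G. z \<in> ends G e} \<subseteq> {e \<in> edges ?G1. z \<in> ends ?G1 e}" using side 2 by auto
      then have "degree G z \<le> degree ?G1 z" unfolding degree_def using finE by (intro card_mono) auto
      then show ?thesis using f1 2 by (simp add: L_def)
    next
      case 3
      have "{e \<in> edges G. z \<in> ends G e} \<subseteq> {e \<in> edges ?G2. z \<in> ends ?G2 e}" using side 3 by auto
      then have "degree G z \<le> degree ?G2 z" unfolding degree_def using finE by (intro card_mono) auto
      then show ?thesis using f2 3 by (simp add: L_def)
    qed
  next
    assume "\<exists>\<phi>. list_coloring G L \<phi>"
    then obtain \<phi> where \<phi>: "coloring G \<phi>" "\<And>z. z \<in> verts G \<Longrightarrow> \<phi> z \<in> L z"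
      by (auto simp: list_coloring_def)
    have "\<phi> v \<in> L1 v \<or> \<phi> v \<in> M v" using \<phi>(2)[OF v] by (simp add: L_def)
    then show False
    proof
      assume "\<phi> v \<in> L1 v"
      then have "\<phi> z \<in> L1 z" if "z \<in> insert v S" for z
        using \<phi>(2)[of z] that S by (cases "z = v") (auto simp: L_def)
      then have "list_coloring ?G1 L1 \<phi>" by (rule list_coloring_induced[OF \<phi>(1)])
      then show False using bad1 by (auto simp: bad_lists_def)
    next
      assume "\<phi> v \<in> M v"
      then have "\<phi> z \<in> M z" if "z \<in> verts G - S" for z
        using \<phi>(2)[of z] that by (cases "z = v") (auto simp: L_def)
      then have "list_coloring ?G2 M \<phi>" by (rule list_coloring_induced[OF \<phi>(1)])
      then show False using badM by (auto simp: bad_lists_def)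
    qed
  qed
  moreover have "0 \<notin> L z" if "z \<in> verts G" for z
    using that nz1[of z] nzM[of z] vS by (auto simp: L_def)
  ultimately show ?thesis by blast
qed

text \<open>Induction by splitting at a separating vertex \<open>v\<close>: \<open>S\<close> is a
  component of \<open>G\<close> minus \<open>v\<close>, and blocks of the two sides
  \<open>insert v S\<close> and \<open>verts G - S\<close> are blocks of \<open>G\<close>. The claim
  about 0 is carried along because gluing needs it of both sides.\<close>

lemma all_blocks_bricks_bad_lists:
  assumes "signed_graph G" "connected_graph G" "\<And>B. block B G \<Longrightarrow> brick B"
  shows "\<exists>L. bad_lists G L \<and> (\<forall>v\<in>verts G. 0 \<notin> L v)"
  using assms
proof (induction "card (verts G)" arbitrary: G rule: less_induct)
  case less
  note G = less.prems(1,2)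
  have finV: "finite (verts G)" using G by (simp add: signed_graph_def)
  show ?case
  proof (cases "nonseparable G")
    case True
    then show ?thesis using block_refl[OF G(1)] less.prems(3) brick_bad_lists by blast
  next
    case False
    then obtain v x y where vxy: "v \<in> verts G" "x \<in> verts G - {v}" "y \<in> verts G - {v}"
      "\<not> reachable (induced G (verts G - {v})) x y"
      using G by (auto simp: nonseparable_def separating_vertex_def remove_vertex_induced)
    let ?H = "induced G (verts G - {v})"
    define S where "S = {z. reachable ?H x z}"
    have sH: "signed_graph ?H" using G by simp
    have SV: "S \<subseteq> verts G - {v}" using reachable_verts[OF sH] vxy(2) by (auto simp: S_def)
    have xS: "x \<in> S" and yS: "y \<notin> S" using vxy(4) by (auto simp: S_def)
    have sep: "b \<in> insert v S" if ab: "adjacent G a b" "a \<in> S" for a b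
    proof (cases "b = v")
      case False
      then have "adjacent ?H a b" using ab SV adjacentD[OF G(1) ab(1)] by (auto simp: adjacent_induced)
      then show ?thesis using ab(2) reachable_step unfolding S_def by fastforce
    qed simp
    have sep1: "b \<in> insert v S" if "adjacent G a b" "a \<in> insert v S - {v}" for a b
      using sep[OF that(1)] that(2) by auto
    have sep2: "b \<in> verts G - S" if ab: "adjacent G a b" "a \<in> verts G - S - {v}" for a b
    proof -
      have "b \<notin> S" using sep[of b a] ab adjacent_sym[of G a b] by auto
      then show ?thesis using adjacentD(2)[OF G(1) ab(1)] by simp
    qed
    have U1: "insert v S \<subseteq> verts G" and U2: "verts G - S \<subseteq> verts G" using SV vxy by auto
    have in1: "v \<in> insert v S" "x \<in> insert v S" "x \<noteq> v" using xS SV by auto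
    have in2: "v \<in> verts G - S" "y \<in> verts G - S" "y \<noteq> v" using yS SV vxy by auto
    have conn1: "connected_graph (induced G (insert v S))"
      using connected_induced_attached[OF G vxy(1) U1 in1(1)] sep1 by blast
    have conn2: "connected_graph (induced G (verts G - S))"
      using connected_induced_attached[OF G vxy(1) U2 in2(1)] sep2 by blast
    have br1: "brick B" if "block B (induced G (insert v S))" for B
      using less.prems(3) block_of_side[OF G U1 in1 _ that] sep1 by blast
    have br2: "brick B" if "block B (induced G (verts G - S))" for B
      using less.prems(3) block_of_side[OF G U2 in2 _ that] sep2 by blast
    \<comment> \<open>The first side misses \<open>y\<close> and the second misses \<open>x\<close>,
      so both are smaller.\<close>
    have "card (insert v S) < card (verts G)"
      using U1 in2 finV by (intro psubset_card_mono) auto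
    then have "\<exists>L. bad_lists (induced G (insert v S)) L \<and> (\<forall>z\<in>insert v S. 0 \<notin> L z)"
      using less.hyps[OF _ signed_graph_induced[OF G(1) U1] conn1 br1] by simp
    moreover have "card (verts G - S) < card (verts G)"
      using in1 xS SV finV vxy by (intro psubset_card_mono) auto
    then have "\<exists>L. bad_lists (induced G (verts G - S)) L \<and> (\<forall>z\<in>verts G - S. 0 \<notin> L z)"
      using less.hyps[OF _ signed_graph_induced[OF G(1) U2] conn2 br2] by simp
    ultimately obtain L1 L2 where
      "bad_lists (induced G (insert v S)) L1" "\<forall>z\<in>insert v S. 0 \<notin> L1 z"
      "bad_lists (induced G (verts G - S)) L2" "\<forall>z\<in>verts G - S. 0 \<notin> L2 z" by blast
    then show ?thesis using bad_lists_glue[OF G(1) vxy(1) SV, of L1 L2] sep by blast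
  qed
qed

theorem theorem7:
  fixes G :: "('a, 'e) sgraph"
  assumes "signed_graph G" and "connected_graph G"
  shows "\<not> degree_choosable G \<longleftrightarrow> (\<forall>B. block B G \<longrightarrow> brick B)"
proof
  assume "\<not> degree_choosable G"
  then obtain L where bad: "bad_lists G L" using not_degree_choosable_iff[OF assms] by blast
  show "\<forall>B. block B G \<longrightarrow> brick B"
  proof (intro allI impI)
    fix B assume B: "block B G"
    then have sub: "subgraph B G" and ns: "nonseparable B" by (auto simp: block_def)
    have V: "verts B \<subseteq> verts G" "verts B \<noteq> {}" and sB: "signed_graph B"
      using sub ns by (auto simp: subgraph_def nonseparable_def connected_graph_def)
    obtain L' where "bad_lists (induced G (verts B)) L'"
      using bad_lists_induced[OF assms bad V] by blast
    then have "bad_lists B L'" using block_eq_induced[OF assms(1) B] by simp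
    then show "brick B" by (rule bad_lists_nonseparable_brick[OF sB ns])
  qed
next
  assume "\<forall>B. block B G \<longrightarrow> brick B"
  then have "\<exists>L. bad_lists G L"
    using all_blocks_bricks_bad_lists[OF assms] by blast
  then show "\<not> degree_choosable G" using not_degree_choosable_iff[OF assms] by blast
qed

end
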